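(* Let $\mathcal{U}$ be an upper LP algebra of rank $n$ over $R$, where $R$ is $\mathbb{Z}$ or a field of characteristic $0$. If $\mathcal{U}=\bigcap_{k=0}^nL_{\mathbf{x}_k}$ for some cluster $\mathbf{x}$ (of an LP seed defining $\mathcal{U}$), where $\mathbf{x}_0=\mathbf{x}$ and $\mathbf{x}_k$ denotes the cluster obtained from $\mathbf{x}$ by LP mutation in direction $k\in[1,n]$, then $\mathcal{U}$ is factorial (a UFD).
   Context: Let $\mathcal{F}$ be the rational function field in $n$ independent variables over the quotient field of $R$; $[1,n]=\{1,\dots,n\}$. A cluster is a set $\mathbf{x}=\{x_1,\dots,x_n\}\subseteq\mathcal{F}$ of $n$ elements algebraically independent over $R$, and $L_{\mathbf{x}}=R[x_1^{\pm1},\dots,x_n^{\pm1}]$. For rational functions $F,G$, $F|_{x_i\leftarrow G}$ denotes the result of substituting $G$ for $x_i$ in $F$; write $x_i\in F$ if $x_i$ appears in $F$ and $x_i\notin F$ otherwise. An LP seed of rank $n$ is a pair $(\mathbf{x},\mathbf{F})$ with $\mathbf{x}$ a cluster and $\mathbf{F}=\{F_1,\dots,F_n\}$ a collection of irreducible elements of $R[\mathbf{x}]$ (irreducible as ring elements) such that for all $i,j\in[1,n]$, $x_j\nmid F_i$, and $F_i$ does not depend on $x_i$. The exchange Laurent polynomials are $\hat F_j=F_j/\prod_{k\ne j}x_k^{a_k}$, where $a_k\in\mathbb{N}_0$ is maximal such that $F_k^{a_k}$ divides $F_j|_{x_k\leftarrow F_k/x}$ in $R[x_1,\dots,x_{k-1},x^{-1},x_{k+1},\dots,x_n]$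 ($x$ a new variable). The LP mutation of $(\mathbf{x},\mathbf{F})$ in direction $k$ is $\mu_k(\mathbf{x},\mathbf{F})=(\mathbf{x}',\mathbf{F}')=(\{x_1,\dots,x_k',\dots,x_n\},\{F_1',\dots,F_k,\dots,F_n'\})$, where $x_k'=\hat F_k/x_k$ and, for $i\neq k$: (1) if $x_k\notin F_i$ then $F_i'=F_i$; (2) if $x_k\in F_i$, then $F_i'$ is obtained as follows: (i) let $G_i=F_i|_{x_k\leftarrow N_k}$ with $N_k=\frac{\hat F_k|_{x_i\leftarrow0}}{x_k'}$; (ii) let $H_i$ be $G_i$ with all common factors between $G_i$ and $\hat F_k|_{x_i\leftarrow0}$ removed (defined up to units); (iii) let $F_i'=MH_i$, where $M$ is a Laurent monomial in the elements of $\mathbf{x}'$ such that $MH_i\in R[\mathbf{x}']$ and $MH_i$ is not divisible by any variable in $\mathbf{x}'$. The result is again an LP seed, well defined up to equivalence, where $(\mathbf{x},\mathbf{F})$ and $(\mathbf{y},\mathbf{G})$ are equivalent if for each $i$ there are $r_i,r_i'\in R^\times$ with $x_i=r_iy_i$ and $F_i=r_i'G_i$; mutation is well defined on equivalence classes. Two LP seeds are mutation-equivalent if their equivalence classes are related by a finite sequence of mutations. The upper LP algebra associated to $(\mathbf{x},\mathbf{F})$ is $\mathcal{U}(\mathbf{x},\mathbf{F})=\bigcap L_{\mathbf{y}}$, the intersection over all LP seeds $(\mathbf{y},\mathbf{G})$ mutation-equivalent to $(\mathbf{x},\mathbf{F})$. *)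

theory Defs
  imports
    "HOL-Library.Poly_Mapping"
    "HOL-Computational_Algebra.Fraction_Field"
    "HOL-Computational_Algebra.Factorial_Ring"
    "HOL-Algebra.Ring_Divisibility"
begin

text \<open>
  The rank is the cardinality of the finite index type \<open>'n\<close>, which plays the role of
  the set of directions \<open>{1, ..., n}\<close>. Its linear order has no mathematical meaning; it is only
  what the library needs to see that polynomials over an integral domain form an integral domain.
  Polynomials in \<open>'n\<close> variables map exponent vectors to coefficients, and the ambient field
  is their quotient field, which is the rational function field over the quotient field of \<open>'r\<close>.
\<close>

type_synonym ('r, 'n) mpol = "('n \<Rightarrow>\<^sub>0 nat) \<Rightarrow>\<^sub>0 'r"
type_synonym ('r, 'n) ratfun = "(('n \<Rightarrow>\<^sub>0 nat) \<Rightarrow>\<^sub>0 'r) fract"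

definition pvar :: "'n \<Rightarrow> ('r::idom, 'n::{finite,linorder}) mpol" where
  "pvar i = Poly_Mapping.single (Poly_Mapping.single i 1) 1"

definition pvars :: "('r::idom, 'n::{finite,linorder}) mpol \<Rightarrow> 'n set" where
  "pvars p = (\<Union>m\<in>Poly_Mapping.keys p. Poly_Mapping.keys m)"

definition of_mpol :: "('r::idom, 'n::{finite,linorder}) mpol \<Rightarrow> ('r, 'n) ratfun" where
  "of_mpol p = Fraction_Field.Fract p 1"

definition const :: "'r::idom \<Rightarrow> ('r, 'n::{finite,linorder}) ratfun" where
  "const c = of_mpol (Poly_Mapping.single 0 c)"

definition xvar :: "'n \<Rightarrow> ('r::idom, 'n::{finite,linorder}) ratfun" where
  "xvar i = of_mpol (pvar i)"

definition mpol_eval ::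
  "('n \<Rightarrow> ('r, 'n) ratfun) \<Rightarrow> ('r::idom, 'n::{finite,linorder}) mpol \<Rightarrow> ('r, 'n) ratfun" where
  "mpol_eval v p = (\<Sum>m\<in>Poly_Mapping.keys p.
     const (Poly_Mapping.lookup p m) * (\<Prod>i\<in>UNIV. v i ^ Poly_Mapping.lookup m i))"

text \<open>
  Simultaneous substitution of \<open>v i\<close> for the \<open>i\<close>-th variable in a rational function. It is
  meaningful when the function can be written with a denominator that does not vanish under the
  substitution; the value is then independent of the chosen fraction.
\<close>

definition ratfun_subst ::
  "('n \<Rightarrow> ('r, 'n) ratfun) \<Rightarrow> ('r::idom, 'n::{finite,linorder}) ratfun \<Rightarrow> ('r, 'n) ratfun" where
  "ratfun_subst v f = (THE g. \<exists>p q. q \<noteq> 0 \<and> f = Fraction_Field.Fract p q \<and>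
     mpol_eval v q \<noteq> 0 \<and> g = mpol_eval v p / mpol_eval v q)"

definition ring_of :: "'f::comm_ring_1 set \<Rightarrow> 'f ring" where
  "ring_of S = \<lparr>carrier = S, monoid.mult = (*), one = 1, zero = 0, add = (+)\<rparr>"

definition alg_independent :: "('n \<Rightarrow> ('r::idom, 'n::{finite,linorder}) ratfun) \<Rightarrow> bool" where
  "alg_independent x \<longleftrightarrow> (\<forall>p. mpol_eval x p = 0 \<longrightarrow> p = 0)"

definition polynomial_ring ::
  "('n \<Rightarrow> ('r::idom, 'n::{finite,linorder}) ratfun) \<Rightarrow> ('r, 'n) ratfun set" where
  "polynomial_ring x = range (mpol_eval x)"

definition laurent_ring ::
  "('n \<Rightarrow> ('r::idom, 'n::{finite,linorder}) ratfun) \<Rightarrow> ('r, 'n) ratfun set" where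
  "laurent_ring x = {mpol_eval x p / (\<Prod>i\<in>UNIV. x i ^ e i) | p e. True}"

text \<open>
  A seed consists of the cluster \<open>x\<close> and the exchange polynomials. Since \<open>x\<close> is algebraically
  independent, \<open>mpol_eval x\<close> is an isomorphism from the polynomial ring onto the subring
  generated by the cluster over the base ring; the exchange polynomials are recorded
  on the side of the polynomial ring, so that \<open>F i\<close> stands for the element
  \<open>mpol_eval x (F i)\<close> of the ambient field.
\<close>

type_synonym ('r, 'n) seed = "('n \<Rightarrow> ('r, 'n) ratfun) \<times> ('n \<Rightarrow> ('r, 'n) mpol)"

definition lp_seed :: "('r::idom, 'n::{finite,linorder}) seed \<Rightarrow> bool" where
  "lp_seed = (\<lambda>(x, F). alg_independent x \<and>
     (\<forall>i. Factorial_Ring.irreducible (F i)) \<and>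
     (\<forall>i j. \<not> pvar j dvd F i) \<and>
     (\<forall>i. i \<notin> pvars (F i)))"

definition seed_equiv ::
  "('r::idom, 'n::{finite,linorder}) seed \<Rightarrow> ('r, 'n) seed \<Rightarrow> bool" where
  "seed_equiv = (\<lambda>(x, F) (y, G). \<forall>i. \<exists>r r'. r dvd 1 \<and> r' dvd 1 \<and>
     x i = const r * y i \<and> mpol_eval x (F i) = const r' * mpol_eval y (G i))"

text \<open>
  In \<open>exch_exponent F j k\<close> the auxiliary new variable is again written \<open>xvar k\<close>: the old one has
  been substituted away in \<open>F j\<close> and does not occur in \<open>F k\<close>.
\<close>

definition exch_exponent ::
  "('n \<Rightarrow> ('r::idom, 'n::{finite,linorder}) mpol) \<Rightarrow> 'n \<Rightarrow> 'n \<Rightarrow> nat" where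
  "exch_exponent F j k = (GREATEST a.
     of_mpol (F k) ^ a
       divides\<^bsub>ring_of (polynomial_ring (xvar(k := inverse (xvar k))))\<^esub>
     mpol_eval (xvar(k := of_mpol (F k) / xvar k)) (F j))"

text \<open>The exchange Laurent polynomials, in the formal variables \<open>xvar\<close>.\<close>

definition exch_laurent ::
  "('n \<Rightarrow> ('r::idom, 'n::{finite,linorder}) mpol) \<Rightarrow> 'n \<Rightarrow> ('r, 'n) ratfun" where
  "exch_laurent F j = of_mpol (F j) / (\<Prod>k\<in>UNIV - {j}. xvar k ^ exch_exponent F j k)"

definition mutated_cluster ::
  "'n \<Rightarrow> ('r::idom, 'n::{finite,linorder}) seed \<Rightarrow> ('n \<Rightarrow> ('r, 'n) ratfun)" where
  "mutated_cluster k = (\<lambda>(x, F). x(k := ratfun_subst x (exch_laurent F k) / x k))"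

text \<open>
  \<open>H\<close> arises from \<open>G\<close> by cancelling factors of \<open>A\<close>, with multiplicity, until \<open>H\<close> and \<open>A\<close>
  have no common factor left. Everything happens in the ring \<open>S\<close>.
\<close>

definition common_factors_removed ::
  "'f::comm_ring_1 set \<Rightarrow> 'f \<Rightarrow> 'f \<Rightarrow> 'f \<Rightarrow> bool" where
  "common_factors_removed S G A H \<longleftrightarrow> H \<in> S \<and>
     (\<exists>cs. (\<forall>c\<in>set cs. c \<in> S \<and> c divides\<^bsub>ring_of S\<^esub> A) \<and> G = prod_list cs * H) \<and>
     (\<forall>d\<in>S. d divides\<^bsub>ring_of S\<^esub> H \<and> d divides\<^bsub>ring_of S\<^esub> A \<longrightarrow> d \<in> Units (ring_of S))"

text \<open>
  The passage from \<open>F i\<close> to \<open>F' i\<close> when the \<open>k\<close>-th variable occurs in \<open>F i\<close>. In \<open>A\<close> the variable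
  \<open>xvar k\<close> does not occur, so from \<open>N\<close> onwards \<open>xvar k\<close> stands for the new cluster variable.
\<close>

definition mutated_polynomial ::
  "('n \<Rightarrow> ('r::idom, 'n::{finite,linorder}) mpol) \<Rightarrow> 'n \<Rightarrow> 'n \<Rightarrow> ('r, 'n) mpol \<Rightarrow> bool" where
  "mutated_polynomial F k i P \<longleftrightarrow>
     (let A = ratfun_subst (xvar(i := 0)) (exch_laurent F k);
          N = A / xvar k;
          G = mpol_eval (xvar(k := N)) (F i)
      in \<exists>H e. common_factors_removed (laurent_ring xvar) G A H \<and>
           of_mpol P = (\<Prod>j\<in>UNIV. xvar j powi e j) * H \<and>
           (\<forall>j. \<not> pvar j dvd P))"

text \<open>
  Mutation is a relation because \<open>H\<close> is only determined up to units; it becomes a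
  function on equivalence classes of seeds.
\<close>

definition lp_mutation ::
  "'n \<Rightarrow> ('r::idom, 'n::{finite,linorder}) seed \<Rightarrow> ('r, 'n) seed \<Rightarrow> bool" where
  "lp_mutation k = (\<lambda>(x, F) (x', F'). x' = mutated_cluster k (x, F) \<and> F' k = F k \<and>
     (\<forall>i. i \<noteq> k \<longrightarrow>
        (if k \<notin> pvars (F i) then F' i = F i else mutated_polynomial F k i (F' i))))"

definition mutation_equivalent ::
  "('r::idom, 'n::{finite,linorder}) seed \<Rightarrow> ('r, 'n) seed \<Rightarrow> bool" where
  "mutation_equivalent = (\<lambda>s t. seed_equiv s t \<or> (\<exists>k. lp_mutation k s t))\<^sup>*\<^sup>*"

definition upper_lp_algebra ::
  "('r::idom, 'n::{finite,linorder}) seed \<Rightarrow> ('r, 'n) ratfun set" where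
  "upper_lp_algebra s =
     \<Inter> {laurent_ring y | y G. lp_seed (y, G) \<and> mutation_equivalent s (y, G)}"

end

theory Submission
  imports Defs "HOL-Computational_Algebra.Polynomial" "HOL-Computational_Algebra.Primes"
begin

text \<open>
  Write \<open>L\<close> for the Laurent ring of the initial cluster \<open>x\<close>, write \<open>D\<^sub>k\<close> for the Laurent ring of
  the cluster obtained from \<open>x\<close> by mutation in direction \<open>k\<close>, and let \<open>q\<^sub>k\<close> be the value of the
  exchange polynomial \<open>F\<^sub>k\<close> at \<open>x\<close>. The hypothesis describes \<open>U\<close> as the intersection of \<open>L\<close> with all
  the \<open>D\<^sub>k\<close>.

  The polynomial ring over the integers or over a field is factorial, and so are its localizations;
  hence \<open>L\<close> and all \<open>D\<^sub>k\<close> are factorial. As \<open>F\<^sub>k\<close> is irreducible, is divisible by no variable and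
  does not involve the variable \<open>k\<close>, the element \<open>q\<^sub>k\<close> is prime in \<open>D\<^sub>k\<close>
  (\<open>exchange_polynomial_prime\<close>), so it defines an order function \<open>v\<^sub>k\<close> on \<open>D\<^sub>k[1/q\<^sub>k]\<close>. The exchange
  relation says that \<open>x\<^sub>k\<close> is \<open>q\<^sub>k\<close> times a unit of \<open>D\<^sub>k\<close>, while the other \<open>x\<^sub>j\<close> are units of \<open>D\<^sub>k\<close>.
  Consequently \<open>L\<close> lies in \<open>D\<^sub>k[1/q\<^sub>k]\<close>, and an element of \<open>L\<close> lies in \<open>D\<^sub>k\<close> exactly when its order is
  nonnegative. So \<open>U\<close> consists of the elements of \<open>L\<close> at which all \<open>v\<^sub>k\<close> are nonnegative, and
  moreover \<open>v\<^sub>k(x\<^sub>j)\<close> is \<open>1\<close> for \<open>j = k\<close> and \<open>0\<close> otherwise.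

  This duality makes \<open>U\<close> factorial (\<open>factorial_nonneg\<close>). The \<open>x\<^sub>j\<close> are units of \<open>L\<close>, so each nonzero \<open>f\<close> in
  \<open>L\<close> can be multiplied by a unique monomial in the \<open>x\<^sub>j\<close> that brings all its orders to zero; let \<open>f\<^sup>*\<close> be
  the product. Then \<open>f = f\<^sup>* \<Prod> x\<^sub>k\<close> with exponents \<open>v\<^sub>k(f)\<close>, and \<open>f \<mapsto> f\<^sup>*\<close> is multiplicative. Thus the
  nonzero elements of \<open>U\<close> form the product of a free monoid on the \<open>x\<^sub>k\<close> with the nonzero elements of \<open>L\<close>
  modulo monomials: the primes of \<open>U\<close> are the \<open>x\<^sub>k\<close> and the \<open>p\<^sup>*\<close> for \<open>p\<close> prime in \<open>L\<close>.
\<close>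

section \<open>Divisibility inside a subring\<close>

text \<open>
  Rings are given as sets of elements of an ambient domain, so that an element passes from a ring to
  its localizations, or to another Laurent ring in the same field, without any maps.
\<close>

locale subdomain =
  fixes A :: "'a::idom set"
  assumes one_mem: "1 \<in> A"
    and diff_mem: "a \<in> A \<Longrightarrow> b \<in> A \<Longrightarrow> a - b \<in> A"
    and mult_mem: "a \<in> A \<Longrightarrow> b \<in> A \<Longrightarrow> a * b \<in> A"
begin

lemma zero_mem: "0 \<in> A"
  using diff_mem[OF one_mem one_mem] by simp

lemma uminus_mem: "a \<in> A \<Longrightarrow> - a \<in> A"
  using diff_mem[OF zero_mem, of a] by simp

lemma add_mem: "a \<in> A \<Longrightarrow> b \<in> A \<Longrightarrow> a + b \<in> A"
  using diff_mem[of a "- b"] uminus_mem[of b] by simp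

lemma power_mem: "a \<in> A \<Longrightarrow> a ^ n \<in> A"
  by (induction n) (auto intro: one_mem mult_mem)

lemma sum_mem: "(\<And>i. i \<in> I \<Longrightarrow> f i \<in> A) \<Longrightarrow> sum f I \<in> A"
  by (induction I rule: infinite_finite_induct) (auto intro: zero_mem add_mem)

lemma prod_mem: "(\<And>i. i \<in> I \<Longrightarrow> f i \<in> A) \<Longrightarrow> prod f I \<in> A"
  by (induction I rule: infinite_finite_induct) (auto intro: one_mem mult_mem)

lemma prod_list_mem: "set as \<subseteq> A \<Longrightarrow> prod_list as \<in> A"
  by (induction as) (auto intro: one_mem mult_mem)

end

definition units_in :: "'a::idom set \<Rightarrow> 'a set" where
  "units_in A = {u \<in> A. \<exists>v\<in>A. u * v = 1}"

definition dvd_in :: "'a::idom set \<Rightarrow> 'a \<Rightarrow> 'a \<Rightarrow> bool" where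
  "dvd_in A a b \<longleftrightarrow> (\<exists>c\<in>A. b = a * c)"

definition prime_in :: "'a::idom set \<Rightarrow> 'a \<Rightarrow> bool" where
  "prime_in A p \<longleftrightarrow> p \<in> A \<and> p \<noteq> 0 \<and> p \<notin> units_in A \<and>
     (\<forall>a\<in>A. \<forall>b\<in>A. dvd_in A p (a * b) \<longrightarrow> dvd_in A p a \<or> dvd_in A p b)"

lemma units_inD: "u \<in> units_in A \<Longrightarrow> u \<in> A" "u \<in> units_in A \<Longrightarrow> u \<noteq> 0"
  by (auto simp: units_in_def)

lemma units_inE:
  assumes "u \<in> units_in A"
  obtains v where "v \<in> units_in A" "u * v = 1" "v * u = 1"
  using assms unfolding units_in_def by (auto simp: mult.commute)

lemma prime_inD:
  assumes "prime_in A p"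
  shows "p \<in> A" "p \<noteq> 0" "p \<notin> units_in A"
    and "a \<in> A \<Longrightarrow> b \<in> A \<Longrightarrow> dvd_in A p (a * b) \<Longrightarrow> dvd_in A p a \<or> dvd_in A p b"
  using assms unfolding prime_in_def by auto

lemma dvd_inI: "b = a * c \<Longrightarrow> c \<in> A \<Longrightarrow> dvd_in A a b"
  by (auto simp: dvd_in_def)

context subdomain
begin

lemma one_units_in: "1 \<in> units_in A"
  by (auto simp: units_in_def one_mem)

lemma mult_units_in:
  assumes "u \<in> units_in A" "v \<in> units_in A"
  shows "u * v \<in> units_in A"
proof -
  obtain u' v' where "u' \<in> units_in A" "u * u' = 1" "v' \<in> units_in A" "v * v' = 1"
    using assms units_inE by metis
  moreover have "u * v * (u' * v') = (u * u') * (v * v')"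
    by (simp only: ac_simps)
  ultimately show ?thesis
    using assms by (auto simp: units_in_def intro!: mult_mem)
qed

lemma units_in_if_mult:
  assumes "a \<in> A" "b \<in> A" "a * b \<in> units_in A"
  shows "a \<in> units_in A"
proof -
  obtain v where "v \<in> A" "a * b * v = 1"
    using assms units_inE units_inD by metis
  with assms show ?thesis
    unfolding units_in_def by (auto intro!: bexI[of _ "b * v"] mult_mem simp: mult.assoc)
qed

lemma dvd_in_mult: "dvd_in A a b \<Longrightarrow> c \<in> A \<Longrightarrow> dvd_in A a (b * c)"
  by (auto simp: dvd_in_def mult.assoc intro: mult_mem)

lemma dvd_in_add: "dvd_in A a b \<Longrightarrow> dvd_in A a c \<Longrightarrow> dvd_in A a (b + c)"
  unfolding dvd_in_def by (metis add_mem distrib_left)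

lemma dvd_in_diff: "dvd_in A a b \<Longrightarrow> dvd_in A a c \<Longrightarrow> dvd_in A a (b - c)"
  unfolding dvd_in_def by (metis diff_mem right_diff_distrib)

lemma dvd_in_sum: "(\<And>i. i \<in> I \<Longrightarrow> dvd_in A a (f i)) \<Longrightarrow> dvd_in A a (sum f I)"
  by (induction I rule: infinite_finite_induct)
    (auto intro: dvd_in_add dvd_inI[of 0 a 0] zero_mem)

lemma prime_not_dvd_unit:
  assumes "prime_in A p" "u \<in> units_in A"
  shows "\<not> dvd_in A p u"
  using assms units_in_if_mult unfolding dvd_in_def prime_in_def by metis

lemma prime_mult_unit:
  assumes p: "prime_in A p" and u: "u \<in> units_in A"
  shows "prime_in A (p * u)"
proof -
  obtain v where v: "v \<in> units_in A" "u * v = 1"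
    using u by (rule units_inE)
  have dvd: "dvd_in A (p * u) a \<longleftrightarrow> dvd_in A p a" for a
  proof
    assume "dvd_in A (p * u) a"
    then show "dvd_in A p a"
      using u by (auto simp: dvd_in_def mult.assoc dest: units_inD intro: mult_mem)
  next
    assume "dvd_in A p a"
    then obtain c where c: "c \<in> A" "a = p * c"
      by (auto simp: dvd_in_def)
    have "a = p * u * (v * c)"
      using c v by (metis mult.assoc mult_1)
    moreover have "v * c \<in> A"
      using c v by (auto intro!: mult_mem dest: units_inD)
    ultimately show "dvd_in A (p * u) a"
      by (rule dvd_inI)
  qed
  have "p * u \<notin> units_in A"
    using p u units_in_if_mult by (meson prime_inD units_inD)
  with p u show ?thesis
    unfolding prime_in_def dvd by (auto intro: mult_mem dest: units_inD)
qed

text \<open>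
  If \<open>q = p c\<close> then \<open>q\<close>, being prime, divides \<open>p\<close> or \<open>c\<close>. Dividing \<open>p\<close> makes \<open>c\<close> a unit;
  dividing \<open>c\<close> would make \<open>p\<close> a unit.
\<close>

lemma primes_associated:
  assumes p: "prime_in A p" and q: "prime_in A q" and dvd: "dvd_in A p q"
  obtains c where "c \<in> units_in A" "q = p * c"
proof -
  obtain c where c: "c \<in> A" "q = p * c"
    using dvd by (auto simp: dvd_in_def)
  have "dvd_in A q (p * c)"
    using c by (intro dvd_inI[of _ _ 1]) (auto intro: one_mem)
  then consider "dvd_in A q p" | "dvd_in A q c"
    using q c(1) p by (meson prime_inD)
  then have "c \<in> units_in A"
  proof cases
    case 1
    then obtain d where d: "d \<in> A" "p = q * d"
      by (auto simp: dvd_in_def)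
    have "p * (c * d) = p * 1"
      using c(2) d(2) by (metis mult.assoc mult_1_right)
    then have "c * d = 1"
      using p by (simp add: prime_in_def)
    then show ?thesis
      using c d by (auto simp: units_in_def)
  next
    case 2
    then obtain d where d: "d \<in> A" "c = q * d"
      by (auto simp: dvd_in_def)
    have "q * (p * d) = q * 1"
      using c(2) d(2) by (metis mult.left_commute mult_1_right)
    then have "p * d = 1"
      using q by (simp add: prime_in_def)
    then have "p \<in> units_in A"
      using p d by (auto simp: units_in_def prime_in_def)
    with p show ?thesis
      by (simp add: prime_in_def)
  qed
  with c that show thesis
    by blast
qed

lemma prime_dvd_prod_list:
  assumes "prime_in A p" "set qs \<subseteq> A" "w \<in> units_in A" "dvd_in A p (w * prod_list qs)"
  shows "\<exists>q\<in>set qs. dvd_in A p q"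
  using assms
proof (induction qs)
  case Nil
  then show ?case
    using prime_not_dvd_unit by simp
next
  case (Cons q qs)
  have "dvd_in A p (q * (w * prod_list qs))"
    using Cons.prems by (simp add: mult.left_commute)
  moreover have "w * prod_list qs \<in> A"
    using Cons.prems by (auto intro!: mult_mem prod_list_mem dest: units_inD)
  ultimately show ?case
    using Cons prime_inD(4) by (metis insert_subset list.set_intros list.simps(15))
qed

text \<open>
  Each prime on the left is associated with one on the right, and the two cancel. The length of a
  factorization into primes is thereby an invariant, which later bounds how often an element can be
  factored.
\<close>

lemma prime_factorization_lengths:
  assumes "\<forall>p\<in>set ps. prime_in A p" "\<forall>q\<in>set qs. prime_in A q"
    and "u \<in> units_in A" "w \<in> units_in A" "u * prod_list ps = w * prod_list qs"
  shows "length ps = length qs"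
  using assms
proof (induction ps arbitrary: qs u w)
  case Nil
  show ?case
  proof (cases qs)
    case (Cons q qs')
    have "dvd_in A q u"
      using Nil Cons
      by (intro dvd_inI[of _ _ "w * prod_list qs'"])
        (auto intro!: mult_mem prod_list_mem simp: mult.left_commute dest: units_inD prime_inD)
    with Nil Cons prime_not_dvd_unit show ?thesis
      by auto
  qed simp
next
  case (Cons p ps)
  have "dvd_in A p (w * prod_list qs)"
    using Cons.prems
    by (intro dvd_inI[of _ _ "u * prod_list ps"])
      (auto intro!: mult_mem prod_list_mem simp: mult.left_commute dest: units_inD prime_inD)
  then obtain q where q: "q \<in> set qs" "dvd_in A p q"
    using prime_dvd_prod_list[of p qs w] Cons.prems by (auto dest: prime_inD)
  then obtain c where c: "c \<in> units_in A" "q = p * c"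
    using primes_associated Cons.prems by (metis list.set_intros(1))
  have "prod_list qs = q * prod_list (remove1 q qs)"
    using q(1) prod_mset_prod_list[of qs] prod_mset_prod_list[of "q # remove1 q qs"]
    by (simp add: insert_DiffM)
  then have "p * (u * prod_list ps) = p * (w * c * prod_list (remove1 q qs))"
    using Cons.prems(5) c by (simp add: algebra_simps)
  then have "u * prod_list ps = w * c * prod_list (remove1 q qs)"
    using Cons.prems(1) by (simp add: prime_in_def)
  moreover have "\<forall>q'\<in>set (remove1 q qs). prime_in A q'"
    using Cons.prems(2) by (meson notin_set_remove1)
  ultimately have "length ps = length (remove1 q qs)"
    using Cons.prems c mult_units_in by (intro Cons.IH[of _ u "w * c"]) simp_all
  with q show ?case
    using length_pos_if_in_set[OF q(1)] by (simp add: length_remove1)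
qed

end

text \<open>
  Factoriality is stated as the existence of factorizations into primes rather than into irreducibles:
  uniqueness is then automatic, and this form passes easily to polynomial rings and localizations.
\<close>

locale factorial_subdomain = subdomain +
  assumes prime_factorization: "a \<in> A \<Longrightarrow> a \<noteq> 0 \<Longrightarrow>
    \<exists>u ps. u \<in> units_in A \<and> (\<forall>p\<in>set ps. prime_in A p) \<and> a = u * prod_list ps"
begin

definition prime_length :: "'a \<Rightarrow> nat" where
  "prime_length a = (THE n. \<exists>u ps. u \<in> units_in A \<and> (\<forall>p\<in>set ps. prime_in A p) \<and>
     a = u * prod_list ps \<and> length ps = n)"

lemma prime_length_eq:
  assumes "u \<in> units_in A" "\<forall>p\<in>set ps. prime_in A p"
  shows "prime_length (u * prod_list ps) = length ps"
  unfolding prime_length_def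
proof (rule the_equality)
  show "\<exists>w qs. w \<in> units_in A \<and> (\<forall>q\<in>set qs. prime_in A q) \<and>
      u * prod_list ps = w * prod_list qs \<and> length qs = length ps"
    using assms by blast
next
  fix n
  assume "\<exists>w qs. w \<in> units_in A \<and> (\<forall>q\<in>set qs. prime_in A q) \<and>
      u * prod_list ps = w * prod_list qs \<and> length qs = n"
  then obtain w qs where "w \<in> units_in A" "\<forall>q\<in>set qs. prime_in A q"
    "u * prod_list ps = w * prod_list qs" "length qs = n"
    by blast
  then show "n = length ps"
    using prime_factorization_lengths[OF assms(2) _ assms(1)] by simp
qed

lemma prime_length_mult:
  assumes "a \<in> A" "b \<in> A" "a \<noteq> 0" "b \<noteq> 0"
  shows "prime_length (a * b) = prime_length a + prime_length b"
proof -
  obtain u ps where a: "u \<in> units_in A" "\<forall>p\<in>set ps. prime_in A p" "a = u * prod_list ps"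
    using assms prime_factorization by blast
  obtain w qs where b: "w \<in> units_in A" "\<forall>p\<in>set qs. prime_in A p" "b = w * prod_list qs"
    using assms prime_factorization by blast
  have ab: "a * b = (u * w) * prod_list (ps @ qs)"
    using a(3) b(3) by (simp add: algebra_simps)
  have "prime_length (a * b) = length (ps @ qs)"
    unfolding ab
    using a(1,2) b(1,2) prime_length_eq[of "u * w" "ps @ qs"] mult_units_in[of u w] by auto
  with a b show ?thesis
    by (simp add: prime_length_eq)
qed

lemma prime_length_eq_0:
  assumes "a \<in> A" "a \<noteq> 0" "prime_length a = 0"
  shows "a \<in> units_in A"
proof -
  obtain u ps where u: "u \<in> units_in A" "\<forall>p\<in>set ps. prime_in A p" "a = u * prod_list ps"
    using prime_factorization[OF assms(1,2)] by blast
  then have "ps = []"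
    using assms(3) prime_length_eq[OF u(1,2)] by simp
  with u show ?thesis
    by simp
qed

lemma irreducible_imp_prime_in:
  assumes a: "a \<in> A" "a \<noteq> 0" "a \<notin> units_in A"
    and irr: "\<And>b c. b \<in> A \<Longrightarrow> c \<in> A \<Longrightarrow> a = b * c \<Longrightarrow> b \<in> units_in A \<or> c \<in> units_in A"
  shows "prime_in A a"
proof -
  obtain u ps where u: "u \<in> units_in A" "\<forall>p\<in>set ps. prime_in A p" "a = u * prod_list ps"
    using a prime_factorization by blast
  with a obtain p qs where ps: "ps = p # qs"
    by (cases ps) auto
  define c where "c = u * prod_list qs"
  have a_eq: "a = p * c"
    using u ps by (simp add: c_def)
  have p: "prime_in A p"
    using u ps by simp
  have c: "c \<in> A"
    unfolding c_def using u ps by (auto intro!: mult_mem prod_list_mem dest: units_inD prime_inD)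
  have "c \<in> units_in A"
    using irr[OF prime_inD(1)[OF p] c a_eq] prime_inD(3)[OF p] by blast
  with p show ?thesis
    unfolding a_eq by (rule prime_mult_unit)
qed

lemma prime_power_split:
  assumes q: "prime_in A q" and a: "a \<in> A" "a \<noteq> 0"
  obtains n b where "b \<in> A" "\<not> dvd_in A q b" "a = q ^ n * b"
proof -
  have "\<exists>n b. b \<in> A \<and> \<not> dvd_in A q b \<and> u * prod_list ps = q ^ n * b"
    if "u \<in> units_in A" "\<forall>p\<in>set ps. prime_in A p" for u ps
    using that
  proof (induction ps arbitrary: u)
    case Nil
    then show ?case
      using prime_not_dvd_unit[OF q, of u]
      by (intro exI[of _ "0::nat"] exI[of _ u]) (auto dest: units_inD)
  next
    case (Cons p ps)
    have p: "prime_in A p" and "\<forall>p\<in>set ps. prime_in A p"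
      using Cons.prems by auto
    then obtain n b where b: "b \<in> A" "\<not> dvd_in A q b" "u * prod_list ps = q ^ n * b"
      using Cons.IH[OF Cons.prems(1)] by blast
    show ?case
    proof (cases "dvd_in A q p")
      case True
      then obtain c where c: "c \<in> units_in A" "p = q * c"
        by (rule primes_associated[OF q p])
      have "\<not> dvd_in A q (c * b)"
        using prime_inD(4)[OF q, of c b] b c(1) prime_not_dvd_unit[OF q c(1)]
          units_inD(1)[OF c(1)] by blast
      moreover have "u * prod_list (p # ps) = q ^ Suc n * (c * b)"
        using b(3) c(2) by (simp add: algebra_simps)
      moreover have "c * b \<in> A"
        using units_inD(1)[OF c(1)] b(1) by (rule mult_mem)
      ultimately show ?thesis
        by blast
    next
      case False
      have "\<not> dvd_in A q (p * b)"
        using prime_inD(4)[OF q, of p b] False b prime_inD(1)[OF p] by blast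
      moreover have "u * prod_list (p # ps) = q ^ n * (p * b)"
        using b(3) by (simp add: algebra_simps)
      moreover have "p * b \<in> A"
        using b(1) prime_inD(1)[OF p] by (rule mult_mem[rotated])
      ultimately show ?thesis
        by blast
    qed
  qed
  note split = this
  obtain u ps where "u \<in> units_in A" "\<forall>p\<in>set ps. prime_in A p" "a = u * prod_list ps"
    using prime_factorization[OF a] by blast
  then obtain n b where "b \<in> A" "\<not> dvd_in A q b" "a = q ^ n * b"
    using split[of u ps] by auto
  then show thesis
    by (rule that)
qed

end

section \<open>Transfer along injective homomorphisms\<close>

text \<open>
  Factoriality is carried from one ambient ring to another along injective homomorphisms, such as
  the evaluation of polynomials at algebraically independent elements.
\<close>

locale subdomain_embedding = subdomain A for A :: "'a::idom set" +
  fixes h :: "'a \<Rightarrow> 'b::idom"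
  assumes hom_one: "h 1 = 1"
    and hom_diff: "a \<in> A \<Longrightarrow> b \<in> A \<Longrightarrow> h (a - b) = h a - h b"
    and hom_mult: "a \<in> A \<Longrightarrow> b \<in> A \<Longrightarrow> h (a * b) = h a * h b"
    and inj: "inj_on h A"
begin

lemma subdomain_image: "subdomain (h ` A)"
  by standard
    (auto simp: hom_one[symmetric] hom_diff[symmetric] hom_mult[symmetric]
      intro!: imageI one_mem diff_mem mult_mem)

lemma hom_eq_iff: "a \<in> A \<Longrightarrow> b \<in> A \<Longrightarrow> h a = h b \<longleftrightarrow> a = b"
  using inj by (auto dest: inj_onD)

lemma hom_zero: "h 0 = 0"
  using hom_diff[OF zero_mem zero_mem] by simp

lemma units_in_image: "a \<in> A \<Longrightarrow> h a \<in> units_in (h ` A) \<longleftrightarrow> a \<in> units_in A"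
  using one_mem hom_one by (auto simp: units_in_def hom_mult[symmetric] hom_eq_iff mult_mem
    simp flip: hom_one)

lemma dvd_in_image: "a \<in> A \<Longrightarrow> b \<in> A \<Longrightarrow> dvd_in (h ` A) (h a) (h b) \<longleftrightarrow> dvd_in A a b"
  by (auto simp: dvd_in_def hom_mult[symmetric] hom_eq_iff mult_mem)

lemma prime_in_image:
  assumes "prime_in A p"
  shows "prime_in (h ` A) (h p)"
proof -
  have p: "p \<in> A" "p \<noteq> 0" "p \<notin> units_in A"
    using assms by (auto simp: prime_in_def)
  have "h p \<noteq> 0"
    using hom_eq_iff[of p 0] p zero_mem hom_zero by simp
  moreover have "dvd_in (h ` A) (h p) (h a) \<or> dvd_in (h ` A) (h p) (h b)"
    if "a \<in> A" "b \<in> A" "dvd_in (h ` A) (h p) (h a * h b)" for a b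
    using that assms p by (simp add: hom_mult[symmetric] dvd_in_image mult_mem prime_in_def)
  ultimately show ?thesis
    unfolding prime_in_def using p by (auto simp: units_in_image)
qed

lemma hom_prod_list: "set as \<subseteq> A \<Longrightarrow> h (prod_list as) = prod_list (map h as)"
  by (induction as) (auto simp: hom_one hom_mult prod_list_mem)

lemma factorial_image:
  assumes "factorial_subdomain A"
  shows "factorial_subdomain (h ` A)"
proof -
  interpret factorial_subdomain A by fact
  show ?thesis
  proof (intro factorial_subdomain.intro subdomain_image factorial_subdomain_axioms.intro)
    fix b assume "b \<in> h ` A" "b \<noteq> 0"
    then obtain a where a: "a \<in> A" "a \<noteq> 0" "b = h a"
      using hom_zero by auto
    then obtain u ps where u: "u \<in> units_in A" "\<forall>p\<in>set ps. prime_in A p" "a = u * prod_list ps"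
      using prime_factorization by blast
    have ps: "set ps \<subseteq> A"
      using u(2) by (auto dest: prime_inD)
    have "b = h u * prod_list (map h ps)"
      using a(3) u units_inD(1)[OF u(1)] ps by (simp add: hom_mult prod_list_mem hom_prod_list)
    moreover have "h u \<in> units_in (h ` A)"
      using units_in_image[OF units_inD(1)[OF u(1)]] u(1) by simp
    moreover have "\<forall>p\<in>set (map h ps). prime_in (h ` A) p"
      using u(2) prime_in_image by auto
    ultimately show "\<exists>u ps. u \<in> units_in (h ` A) \<and> (\<forall>p\<in>set ps. prime_in (h ` A) p) \<and>
        b = u * prod_list ps"
      by blast
  qed
qed

end

section \<open>Polynomials over a factorial subring\<close>

definition polys_over :: "'a::idom set \<Rightarrow> 'a poly set" where
  "polys_over A = {f. \<forall>i. Polynomial.coeff f i \<in> A}"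

context subdomain
begin

lemma polys_over_subdomain: "subdomain (polys_over A)"
proof
  show "1 \<in> polys_over A"
    by (auto simp: polys_over_def coeff_1 intro: one_mem zero_mem)
qed (auto simp: polys_over_def coeff_mult intro!: diff_mem sum_mem mult_mem)

interpretation polys: subdomain "polys_over A"
  by (rule polys_over_subdomain)

lemma monom_polys_over: "a \<in> A \<Longrightarrow> Polynomial.monom a n \<in> polys_over A"
  by (auto simp: polys_over_def coeff_monom intro: zero_mem)

lemma const_polys_over: "[:a:] \<in> polys_over A \<longleftrightarrow> a \<in> A"
  by (auto simp: polys_over_def coeff_pCons zero_mem split: nat.splits)

lemma smult_polys_over: "a \<in> A \<Longrightarrow> f \<in> polys_over A \<Longrightarrow> smult a f \<in> polys_over A"
  by (auto simp: polys_over_def intro: mult_mem)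

lemma units_polys_over: "units_in (polys_over A) = (\<lambda>u. [:u:]) ` units_in A"
proof (intro equalityI subsetI)
  fix f assume "f \<in> units_in (polys_over A)"
  then obtain g where fg: "f \<in> polys_over A" "g \<in> polys_over A" "f * g = 1"
    by (auto simp: units_in_def)
  then have "f \<noteq> 0" "g \<noteq> 0"
    by auto
  then have "degree f + degree g = 0"
    using fg(3) degree_mult_eq[of f g] by simp
  then obtain a b where ab: "f = [:a:]" "g = [:b:]"
    by (metis add_is_0 degree_eq_zeroE)
  then have "a \<in> units_in A"
    using fg by (auto simp: units_in_def const_polys_over one_pCons mult.commute)
  with ab show "f \<in> (\<lambda>u. [:u:]) ` units_in A"
    by blast
next
  fix f assume "f \<in> (\<lambda>u. [:u:]) ` units_in A"
  then obtain a b where "f = [:a:]" "a \<in> A" "b \<in> A" "a * b = 1"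
    by (auto simp: units_in_def)
  then show "f \<in> units_in (polys_over A)"
    unfolding units_in_def by (auto simp: const_polys_over one_pCons intro!: bexI[of _ "[:b:]"])
qed

lemma const_dvd_in_polys_iff:
  assumes "a \<in> A" "a \<noteq> 0" "f \<in> polys_over A"
  shows "dvd_in (polys_over A) [:a:] f \<longleftrightarrow> (\<forall>i. dvd_in A a (Polynomial.coeff f i))"
proof
  assume "\<forall>i. dvd_in A a (Polynomial.coeff f i)"
  then obtain c where c: "\<And>i. c i \<in> A" "\<And>i. Polynomial.coeff f i = a * c i"
    unfolding dvd_in_def by metis
  define g where "g = (\<Sum>i\<le>degree f. Polynomial.monom (c i) i)"
  have "g \<in> polys_over A"
    unfolding g_def by (intro polys.sum_mem monom_polys_over c)
  moreover have "f = [:a:] * g"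
  proof (rule poly_eqI)
    fix i
    have "c i = 0" if "i > degree f"
      using c(2)[of i] that assms(2) by (simp add: coeff_eq_0)
    then show "Polynomial.coeff f i = Polynomial.coeff ([:a:] * g) i"
      by (auto simp: g_def coeff_sum coeff_monom c(2))
  qed
  ultimately show "dvd_in (polys_over A) [:a:] f"
    by (auto simp: dvd_in_def)
qed (auto simp: dvd_in_def polys_over_def)

text \<open>
  Gauss's lemma: take in both factors the first coefficient that \<open>p\<close> does not divide. In the
  coefficient of the product at the sum of the two indices, their product is the only term that \<open>p\<close>
  does not divide.
\<close>

lemma const_prime_in_polys:
  assumes p: "prime_in A p"
  shows "prime_in (polys_over A) [:p:]"
proof -
  have pA: "p \<in> A" "p \<noteq> 0"
    using p by (auto simp: prime_in_def)
  have "dvd_in (polys_over A) [:p:] f \<or> dvd_in (polys_over A) [:p:] g"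
    if fg: "f \<in> polys_over A" "g \<in> polys_over A" "dvd_in (polys_over A) [:p:] (f * g)" for f g
  proof (rule ccontr)
    assume contra: "\<not> ?thesis"
    define P where "P f i \<longleftrightarrow> \<not> dvd_in A p (Polynomial.coeff f i)" for f i
    \<comment> \<open>The first coefficients of \<open>f\<close> and \<open>g\<close> not divisible by \<open>p\<close>.\<close>
    define i where "i = (LEAST i. P f i)"
    define j where "j = (LEAST j. P g j)"
    have ex: "\<exists>i. P f i" "\<exists>i. P g i"
      using contra fg pA by (auto simp: const_dvd_in_polys_iff P_def)
    have i: "P f i" and j: "P g j"
      unfolding i_def j_def using ex by (auto intro: LeastI_ex)
    have less_i: "dvd_in A p (Polynomial.coeff f k)" if "k < i" for k
      using not_less_Least[of k "P f"] that by (auto simp: i_def P_def)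
    have less_j: "dvd_in A p (Polynomial.coeff g k)" if "k < j" for k
      using not_less_Least[of k "P g"] that by (auto simp: j_def P_def)
    let ?t = "\<lambda>k. Polynomial.coeff f k * Polynomial.coeff g (i + j - k)"
    have mem: "Polynomial.coeff f k \<in> A" "Polynomial.coeff g k \<in> A" for k
      using fg by (auto simp: polys_over_def)
    have "dvd_in A p (?t k)" if "k \<in> {..i + j} - {i}" for k
    proof (cases "k < i")
      case True
      then show ?thesis
        by (intro dvd_in_mult less_i mem)
    next
      case False
      with that have "i + j - k < j"
        by auto
      then show ?thesis
        by (subst mult.commute) (intro dvd_in_mult less_j mem)
    qed
    then have rest: "dvd_in A p (sum ?t ({..i + j} - {i}))"
      by (rule dvd_in_sum)
    have all: "dvd_in A p (sum ?t {..i + j})"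
      using fg pA const_dvd_in_polys_iff[of p "f * g"] by (simp add: coeff_mult polys.mult_mem)
    have "sum ?t {..i + j} - sum ?t ({..i + j} - {i}) = ?t i"
      by (subst sum.remove[of _ i]) auto
    with dvd_in_diff[OF all rest] have "dvd_in A p (?t i)"
      by simp
    then show False
      using i j prime_inD(4)[OF p mem] by (auto simp: P_def)
  qed
  then show ?thesis
    unfolding prime_in_def using p by (auto simp: const_polys_over units_polys_over prime_in_def)
qed

text \<open>
  Division with remainder succeeds after multiplication by a power of the leading coefficient of the
  divisor.
\<close>

lemma pseudo_division:
  assumes "f \<in> polys_over A" "d \<in> polys_over A" "d \<noteq> 0"
  shows "\<exists>a q r. a \<in> A \<and> a \<noteq> 0 \<and> q \<in> polys_over A \<and> r \<in> polys_over A \<and>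
    smult a f = q * d + r \<and> (r = 0 \<or> degree r < degree d)"
  using assms
proof (induction "if f = 0 then 0 else Suc (degree f)" arbitrary: f rule: less_induct)
  case less
  show ?case
  proof (cases "f = 0 \<or> degree f < degree d")
    case True
    then show ?thesis
      using less.prems
      by (intro exI[of _ 1] exI[of _ 0] exI[of _ f]) (auto intro: one_mem polys.zero_mem)
  next
    case False
    define m where "m = Polynomial.monom (lead_coeff f) (degree f - degree d)"
    \<comment> \<open>One step of long division: the leading terms cancel.\<close>
    define f' where "f' = smult (lead_coeff d) f - m * d"
    have lc: "lead_coeff f \<in> A" "lead_coeff d \<in> A" "lead_coeff d \<noteq> 0"
      using less.prems by (auto simp: polys_over_def)
    have m: "m \<in> polys_over A"
      unfolding m_def by (intro monom_polys_over lc)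
    have f': "f' \<in> polys_over A"
      unfolding f'_def using less.prems lc m
      by (intro polys.diff_mem smult_polys_over polys.mult_mem)
    have "degree (m * d) \<le> degree f"
      using degree_mult_le[of m d] degree_monom_le[of "lead_coeff f" "degree f - degree d"] False
      unfolding m_def by linarith
    then have "degree f' \<le> degree f"
      unfolding f'_def by (intro degree_diff_le degree_smult_le)
    moreover have "Polynomial.coeff f' (degree f) = 0"
      using False by (simp add: f'_def m_def coeff_monom_mult)
    ultimately have "f' = 0 \<or> degree f' < degree f"
      by (rule eq_zero_or_degree_less)
    then have "(if f' = 0 then 0 else Suc (degree f')) < (if f = 0 then 0 else Suc (degree f))"
      using False by auto
    from less.hyps[OF this f' less.prems(2,3)]
    obtain a q r where IH: "a \<in> A" "a \<noteq> 0" "q \<in> polys_over A" "r \<in> polys_over A"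
      "smult a f' = q * d + r" "r = 0 \<or> degree r < degree d"
      by blast
    have "smult (a * lead_coeff d) f = (q + smult a m) * d + r"
      using IH(5) by (simp add: f'_def smult_diff_right algebra_simps)
    moreover have "q + smult a m \<in> polys_over A"
      using IH m by (intro polys.add_mem smult_polys_over)
    moreover have "a * lead_coeff d \<in> A" "a * lead_coeff d \<noteq> 0"
      using IH lc by (auto intro: mult_mem)
    ultimately show ?thesis
      using IH by blast
  qed
qed

end

context factorial_subdomain
begin

interpretation polys: subdomain "polys_over A"
  by (rule polys_over_subdomain)

text \<open>
  The prime factors of the constant \<open>a\<close> are distributed over the two factors \<open>q\<close> and \<open>d\<close> by Gauss's
  lemma; \<open>c\<close> collects those that \<open>d\<close> absorbs.
\<close>

lemma cancel_constant:
  assumes "a \<in> A" "a \<noteq> 0" "f \<in> polys_over A" "q \<in> polys_over A" "d \<in> polys_over A"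
    and "smult a f = q * d"
  obtains c q1 d1 where "c \<in> A" "q1 \<in> polys_over A" "d1 \<in> polys_over A"
    "f = q1 * d1" "d = smult c d1"
proof -
  have claim: "\<exists>c q1 d1. c \<in> A \<and> q1 \<in> polys_over A \<and> d1 \<in> polys_over A \<and>
      f = q1 * d1 \<and> d = smult c d1"
    if "u \<in> units_in A" "\<forall>p\<in>set ps. prime_in A p"
      "q \<in> polys_over A" "d \<in> polys_over A" "smult (u * prod_list ps) f = q * d"
    for u ps q d
    using that
  proof (induction ps arbitrary: q d)
    case Nil
    obtain v where v: "v \<in> units_in A" "v * u = 1"
      using Nil.prems(1) by (metis units_inE)
    have "f = smult (v * u) f"
      using v by simp
    also have "\<dots> = smult v q * d"
      using Nil.prems(5) by (simp flip: smult_smult)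
    finally have "f = smult v q * d" .
    moreover have "smult v q \<in> polys_over A"
      using units_inD(1)[OF v(1)] Nil.prems(3) by (rule smult_polys_over)
    ultimately show ?case
      using Nil.prems(4) one_mem by (intro exI[of _ 1] exI[of _ "smult v q"] exI[of _ d]) simp
  next
    case (Cons p ps)
    let ?g = "smult (u * prod_list ps) f"
    have p: "prime_in A p" and ps: "\<forall>p\<in>set ps. prime_in A p"
      using Cons.prems by auto
    have pA: "p \<in> A" "p \<noteq> 0"
      using p by (auto simp: prime_in_def)
    have "u * prod_list ps \<in> A"
      using ps Cons.prems(1) by (auto intro!: mult_mem prod_list_mem dest: units_inD prime_inD)
    then have g: "?g \<in> polys_over A"
      using assms(3) by (rule smult_polys_over)
    have eq: "smult p ?g = q * d"
      using Cons.prems(5) by (simp add: mult.left_commute)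
    then have "dvd_in (polys_over A) [:p:] (q * d)"
      using g by (intro dvd_inI[of _ _ ?g]) (simp_all only: mult_pCons_left mult_zero_left
        pCons_0_0 add_0_right)
    then consider "dvd_in (polys_over A) [:p:] q" | "dvd_in (polys_over A) [:p:] d"
      using prime_inD(4)[OF const_prime_in_polys[OF p]] Cons.prems by blast
    then show ?case
    proof cases
      case 1
      then obtain q' where q': "q' \<in> polys_over A" "q = smult p q'"
        by (auto simp: dvd_in_def)
      then have "smult p ?g = smult p (q' * d)"
        using eq by simp
      then have "?g = q' * d"
        using pA(2) smult_cancel by blast
      then show ?thesis
        using Cons.IH[OF Cons.prems(1) ps q'(1) Cons.prems(4)] by blast
    next
      case 2
      then obtain d' where d': "d' \<in> polys_over A" "d = smult p d'"
        by (auto simp: dvd_in_def)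
      then have "smult p ?g = smult p (q * d')"
        using eq by simp
      then have "?g = q * d'"
        using pA(2) smult_cancel by blast
      then obtain c q1 d1 where "c \<in> A" "q1 \<in> polys_over A" "d1 \<in> polys_over A"
        "f = q1 * d1" "d' = smult c d1"
        using Cons.IH[OF Cons.prems(1) ps Cons.prems(3) d'(1)] by blast
      with d' pA show ?thesis
        by (intro exI[of _ "p * c"] exI[of _ q1] exI[of _ d1]) (auto intro: mult_mem)
    qed
  qed
  obtain u ps where u: "u \<in> units_in A" "\<forall>p\<in>set ps. prime_in A p" "a = u * prod_list ps"
    using prime_factorization[OF assms(1,2)] by blast
  show thesis
    using claim[OF u(1,2) assms(4,5)] assms(6) u(3) that by blast
qed

text \<open>
  Suppose \<open>f\<close> divides \<open>g h\<close>, and choose a nonzero \<open>d\<close> of least degree in the ideal generated by \<open>f\<close>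
  and \<open>g\<close>. By pseudo-division \<open>d\<close> divides \<open>f\<close> and \<open>g\<close> up to constants. As \<open>f\<close> is irreducible,
  \<open>d\<close> is, up to constants, either \<open>f\<close>, which then divides \<open>g\<close>, or \<open>1\<close>; in the latter case a constant
  is a combination of \<open>f\<close> and \<open>g\<close>, and multiplying by \<open>h\<close> shows that \<open>f\<close> divides \<open>h\<close>. Constants are
  cancelled at the end, as the irreducible \<open>f\<close> has no constant factors.
\<close>

lemma irreducible_poly_is_prime:
  assumes f: "f \<in> polys_over A" "degree f > 0"
    and irr: "\<And>g h. g \<in> polys_over A \<Longrightarrow> h \<in> polys_over A \<Longrightarrow> f = g * h \<Longrightarrow>
      g \<in> units_in (polys_over A) \<or> h \<in> units_in (polys_over A)"
  shows "prime_in (polys_over A) f"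
proof -
  let ?P = "polys_over A"
  have nonconst: "f \<noteq> smult c u" if "u \<in> units_in ?P" for c u
    using that f(2) by (auto simp: units_polys_over)
  have f0: "f \<noteq> 0"
    using f(2) by auto
  \<comment> \<open>An irreducible nonconstant polynomial has only unit constant factors, so constants cancel.\<close>
  have primitive: "dvd_in ?P f g"
    if gt: "g \<in> ?P" "t \<in> ?P" "b \<in> A" "b \<noteq> 0" "smult b g = t * f" for g t b
  proof -
    obtain c q1 f1 where c: "c \<in> A" "q1 \<in> ?P" "f1 \<in> ?P" "g = q1 * f1" "f = smult c f1"
      by (rule cancel_constant[OF gt(3,4,1,2) f(1) gt(5)])
    have "[:c:] \<in> units_in ?P"
      using irr[of "[:c:]" f1] c nonconst by (auto simp: const_polys_over)
    then have "c \<in> units_in A"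
      by (auto simp: units_polys_over)
    then obtain v where v: "v \<in> A" "v * c = 1"
      by (auto simp: units_in_def mult.commute)
    have "f * smult v q1 = smult (v * c) (f1 * q1)"
      unfolding c(5) by simp
    then have "g = f * smult v q1"
      using v(2) c(4) by (simp add: mult.commute)
    moreover have "smult v q1 \<in> ?P"
      using v(1) c(2) by (rule smult_polys_over)
    ultimately show ?thesis
      by (rule dvd_inI)
  qed
  have "dvd_in ?P f g \<or> dvd_in ?P f h"
    if gh: "g \<in> ?P" "h \<in> ?P" "dvd_in ?P f (g * h)" for g h
  proof -
    define I where "I = {u * f + v * g | u v. u \<in> ?P \<and> v \<in> ?P}"
    have fI: "f \<in> I"
      unfolding I_def using polys.one_mem polys.zero_mem
      by (intro CollectI exI[of _ 1] exI[of _ 0]) auto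
    have gI: "g \<in> I"
      unfolding I_def using polys.one_mem polys.zero_mem
      by (intro CollectI exI[of _ 0] exI[of _ 1]) auto
    define d where "d = (ARG_MIN degree e. e \<in> I \<and> e \<noteq> 0)"
    have d: "d \<in> I" "d \<noteq> 0" and d_min: "\<And>e. e \<in> I \<Longrightarrow> e \<noteq> 0 \<Longrightarrow> degree d \<le> degree e"
      using arg_min_nat_lemma[of "\<lambda>e. e \<in> I \<and> e \<noteq> 0" f degree] fI f0 by (auto simp: d_def)
    obtain u v where uv: "u \<in> ?P" "v \<in> ?P" "d = u * f + v * g"
      using d by (auto simp: I_def)
    have dP: "d \<in> ?P"
      unfolding uv(3) using uv f gh by (intro polys.add_mem polys.mult_mem)
    have multiple: "\<exists>a q. a \<in> A \<and> a \<noteq> 0 \<and> q \<in> ?P \<and> smult a e = q * d" if e: "e \<in> I" for e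
    proof -
      obtain x y where xy: "x \<in> ?P" "y \<in> ?P" "e = x * f + y * g"
        using e by (auto simp: I_def)
      have "e \<in> ?P"
        unfolding xy(3) using xy f gh by (intro polys.add_mem polys.mult_mem)
      then obtain a q r where r: "a \<in> A" "a \<noteq> 0" "q \<in> ?P" "r \<in> ?P" "smult a e = q * d + r"
        "r = 0 \<or> degree r < degree d"
        using pseudo_division[OF _ dP d(2)] by blast
      have "r = (smult a x - q * u) * f + (smult a y - q * v) * g"
        using r(5) unfolding xy(3) uv(3) by (simp add: algebra_simps smult_add_right)
      moreover have "smult a x - q * u \<in> ?P" "smult a y - q * v \<in> ?P"
        using r xy uv by (auto intro!: polys.diff_mem polys.mult_mem smult_polys_over)
      ultimately have "r \<in> I"
        unfolding I_def by blast
      then have "r = 0"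
        using r(6) d_min[of r] by (metis not_le)
      with r show ?thesis
        by auto
    qed
    obtain a q where a: "a \<in> A" "a \<noteq> 0" "q \<in> ?P" "smult a f = q * d"
      using multiple[OF fI] by blast
    obtain c q1 d1 where c: "c \<in> A" "q1 \<in> ?P" "d1 \<in> ?P" "f = q1 * d1" "d = smult c d1"
      by (rule cancel_constant[OF a(1,2) f(1) a(3) dP a(4)])
    consider "q1 \<in> units_in ?P" | "d1 \<in> units_in ?P"
      using irr[OF c(2,3,4)] by blast
    then show ?thesis
    proof cases
      case 1
      then obtain w where w: "w \<in> ?P" "w * q1 = 1"
        by (auto simp: units_in_def mult.commute)
      have "d1 = w * f"
        using w(2) c(4) by (metis mult.assoc mult_1)
      then have d_eq: "d = smult c w * f"
        using c(5) by simp
      obtain b q' where b: "b \<in> A" "b \<noteq> 0" "q' \<in> ?P" "smult b g = q' * d"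
        using multiple[OF gI] by blast
      have "smult b g = (q' * smult c w) * f"
        using b(4) d_eq by (simp add: mult.assoc)
      moreover have "q' * smult c w \<in> ?P"
        using b c w by (intro polys.mult_mem smult_polys_over)
      ultimately show ?thesis
        using primitive gh(1) b(1,2) by blast
    next
      case 2
      then obtain w where w: "w \<in> A" "d1 = [:w:]"
        by (auto simp: units_polys_over dest: units_inD)
      obtain k where k: "k \<in> ?P" "g * h = f * k"
        using gh(3) by (auto simp: dvd_in_def)
      have "[:c * w:] = u * f + v * g"
        using c(5) w(2) uv(3) by simp
      then have "[:c * w:] * h = (u * h) * f + v * (g * h)"
        by (simp add: algebra_simps)
      then have "smult (c * w) h = (u * h + v * k) * f"
        unfolding k(2) by (simp add: algebra_simps)
      moreover have "c * w \<in> A" "c * w \<noteq> 0"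
        using c w d(2) by (auto intro: mult_mem)
      moreover have "u * h + v * k \<in> ?P"
        using uv k gh by (intro polys.add_mem polys.mult_mem)
      ultimately show ?thesis
        using primitive gh(2) by blast
    qed
  qed
  moreover have "f \<notin> units_in ?P"
    using nonconst[of f 1] by auto
  ultimately show ?thesis
    unfolding prime_in_def using f(1) f0 by blast
qed

text \<open>
  The degree plus the number of prime factors of the leading coefficient is additive on products and
  vanishes only on units, so repeated splitting ends in irreducible factors, which are prime.
\<close>

theorem factorial_polys_over: "factorial_subdomain (polys_over A)"
proof (intro factorial_subdomain.intro polys_over_subdomain factorial_subdomain_axioms.intro)
  let ?P = "polys_over A"
  define N where "N f = degree f + prime_length (lead_coeff f)" for f
  have lc: "lead_coeff f \<in> A" if "f \<in> ?P" for f
    using that by (auto simp: polys_over_def)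
  have N_mult: "N (f * g) = N f + N g" if "f \<in> ?P" "g \<in> ?P" "f \<noteq> 0" "g \<noteq> 0" for f g
    using that by (simp add: N_def lead_coeff_mult prime_length_mult lc)
      (simp add: degree_mult_eq)
  have N_0: "f \<in> units_in ?P" if "f \<in> ?P" "f \<noteq> 0" "N f = 0" for f
  proof -
    obtain a where "f = [:a:]"
      using \<open>N f = 0\<close> by (auto simp: N_def elim: degree_eq_zeroE)
    then show ?thesis
      using that prime_length_eq_0[of a] by (auto simp: N_def units_polys_over const_polys_over)
  qed
  fix f assume "f \<in> ?P" "f \<noteq> 0"
  then show "\<exists>u ps. u \<in> units_in ?P \<and> (\<forall>p\<in>set ps. prime_in ?P p) \<and> f = u * prod_list ps"
  proof (induction "N f" arbitrary: f rule: less_induct)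
    case less
    consider "f \<in> units_in ?P"
      | g h where "f \<notin> units_in ?P" "g \<in> ?P" "h \<in> ?P" "f = g * h"
          "g \<notin> units_in ?P" "h \<notin> units_in ?P"
      | "f \<notin> units_in ?P" "\<And>g h. g \<in> ?P \<Longrightarrow> h \<in> ?P \<Longrightarrow> f = g * h \<Longrightarrow>
          g \<in> units_in ?P \<or> h \<in> units_in ?P"
      by blast
    then show ?case
    proof cases
      case 1
      then show ?thesis
        by (intro exI[of _ f] exI[of _ "[]"]) auto
    next
      case (2 g h)
      have gh0: "g \<noteq> 0" "h \<noteq> 0"
        using less.prems 2 by auto
      have "N f = N g + N h"
        unfolding 2(4) using 2 gh0 by (intro N_mult)
      moreover have "N g \<noteq> 0" "N h \<noteq> 0"
        using N_0 2 gh0 by blast+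
      ultimately have "N g < N f" "N h < N f"
        by auto
      then obtain u ps w qs where "u \<in> units_in ?P" "\<forall>p\<in>set ps. prime_in ?P p" "g = u * prod_list ps"
        "w \<in> units_in ?P" "\<forall>p\<in>set qs. prime_in ?P p" "h = w * prod_list qs"
        using less.hyps[of g] less.hyps[of h] 2(2,3) gh0 by blast
      with 2(4) show ?thesis
        by (intro exI[of _ "u * w"] exI[of _ "ps @ qs"])
          (auto simp: algebra_simps intro: polys.mult_units_in)
    next
      case 3
      have "prime_in ?P f"
      proof (cases "degree f = 0")
        case True
        then obtain a where a: "f = [:a:]"
          by (rule degree_eq_zeroE)
        have "prime_in A a"
        proof (rule irreducible_imp_prime_in)
          show "a \<in> A" "a \<noteq> 0" "a \<notin> units_in A"
            using less.prems 3(1) a by (auto simp: const_polys_over units_polys_over)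
          fix b c assume "b \<in> A" "c \<in> A" "a = b * c"
          then show "b \<in> units_in A \<or> c \<in> units_in A"
            using 3(2)[of "[:b:]" "[:c:]"] a by (auto simp: const_polys_over units_polys_over)
        qed
        then show ?thesis
          unfolding a by (rule const_prime_in_polys)
      next
        case False
        then show ?thesis
          using less.prems 3(2) by (intro irreducible_poly_is_prime) auto
      qed
      then show ?thesis
        using polys.one_units_in by (intro exI[of _ 1] exI[of _ "[f]"]) auto
    qed
  qed
qed

end

section \<open>Multivariate polynomials over the integers or a field\<close>

lemma UNIV_subdomain: "subdomain (UNIV :: 'a::idom set)"
  by standard auto

lemma units_in_UNIV: "units_in (UNIV :: 'a::idom set) = {u. u dvd 1}"
  by (auto simp: units_in_def dvd_def)

lemma dvd_in_UNIV: "dvd_in (UNIV :: 'a::idom set) a b \<longleftrightarrow> a dvd b"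
  by (auto simp: dvd_in_def dvd_def)

lemma prime_in_UNIV: "prime_in (UNIV :: 'a::idom set) p \<longleftrightarrow> Factorial_Ring.prime_elem p"
  by (simp add: prime_in_def prime_elem_def units_in_UNIV dvd_in_UNIV)

lemma factorial_int: "factorial_subdomain (UNIV :: int set)"
proof (intro factorial_subdomain.intro UNIV_subdomain factorial_subdomain_axioms.intro)
  fix a :: int assume "a \<noteq> 0"
  then obtain M where M: "\<And>p. p \<in># M \<Longrightarrow> Factorial_Ring.prime p"
    "normalize (prod_mset M) = normalize a"
    using prime_factorization_exists' by metis
  obtain ps where ps: "mset ps = M"
    using ex_mset by blast
  have "\<bar>prod_list ps\<bar> = \<bar>a\<bar>"
    using M(2) prod_mset_prod_list[of ps] unfolding ps by simp
  then have "a = 1 * prod_list ps \<or> a = (-1) * prod_list ps"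
    by auto
  moreover have "1 \<in> units_in (UNIV :: int set)" "-1 \<in> units_in (UNIV :: int set)"
    by (auto simp: units_in_UNIV)
  moreover have "\<forall>p\<in>set ps. prime_in UNIV p"
    unfolding prime_in_UNIV using M(1) ps by (metis prime_imp_prime_elem set_mset_mset)
  ultimately show "\<exists>u ps. u \<in> units_in UNIV \<and> (\<forall>p\<in>set ps. prime_in UNIV p) \<and> a = u * prod_list ps"
    by blast
qed

lemma factorial_base_ring:
  assumes "surj (of_int :: int \<Rightarrow> 'r::{idom,ring_char_0}) \<or> (\<forall>a::'r. a \<noteq> 0 \<longrightarrow> a dvd 1)"
  shows "factorial_subdomain (UNIV :: 'r set)"
  using assms
proof
  assume surj: "surj (of_int :: int \<Rightarrow> 'r)"
  interpret subdomain_embedding UNIV "of_int :: int \<Rightarrow> 'r"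
    by (intro subdomain_embedding.intro UNIV_subdomain subdomain_embedding_axioms.intro)
      (auto simp: inj_on_def)
  show ?thesis
    using factorial_image[OF factorial_int] surj by simp
next
  assume units: "\<forall>a::'r. a \<noteq> 0 \<longrightarrow> a dvd 1"
  show ?thesis
  proof (intro factorial_subdomain.intro UNIV_subdomain factorial_subdomain_axioms.intro)
    fix a :: 'r assume "a \<noteq> 0"
    then show "\<exists>u ps. u \<in> units_in UNIV \<and> (\<forall>p\<in>set ps. prime_in UNIV p) \<and> a = u * prod_list ps"
      using units by (intro exI[of _ a] exI[of _ "[]"]) (auto simp: units_in_UNIV)
  qed
qed

definition mpols_in :: "'n set \<Rightarrow> ('r::idom, 'n::{finite,linorder}) mpol set" where
  "mpols_in V = {p. pvars p \<subseteq> V}"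

lemma mpols_in_iff:
  "p \<in> mpols_in V \<longleftrightarrow>
    (\<forall>m i. Poly_Mapping.lookup p m \<noteq> 0 \<longrightarrow> i \<notin> V \<longrightarrow> Poly_Mapping.lookup m i = 0)"
proof -
  have "p \<in> mpols_in V \<longleftrightarrow>
      (\<forall>m. m \<in> Poly_Mapping.keys p \<longrightarrow> (\<forall>i. i \<in> Poly_Mapping.keys m \<longrightarrow> i \<in> V))"
    by (auto simp only: mpols_in_def pvars_def)
  then show ?thesis
    unfolding in_keys_iff by metis
qed

lemma mpols_in_UNIV: "mpols_in UNIV = UNIV"
  by (simp add: mpols_in_def)

lemma pvar_mem_mpols_in: "i \<in> V \<Longrightarrow> pvar i \<in> mpols_in V"
  by (auto simp: mpols_in_def pvars_def pvar_def)

lemma const_mem_mpols_in: "Poly_Mapping.single 0 c \<in> mpols_in V"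
  by (auto simp: mpols_in_def pvars_def)

lemma mpols_in_subdomain: "subdomain (mpols_in V)"
proof
  show "1 \<in> mpols_in V"
    by (auto simp: mpols_in_def pvars_def)
next
  fix p q :: "('b, 'a) mpol" assume pq: "p \<in> mpols_in V" "q \<in> mpols_in V"
  show "p - q \<in> mpols_in V"
    unfolding mpols_in_iff
  proof (intro allI impI)
    fix m i assume "Poly_Mapping.lookup (p - q) m \<noteq> 0" "i \<notin> V"
    then show "Poly_Mapping.lookup m i = 0"
      using pq unfolding mpols_in_iff lookup_minus by (metis diff_zero)
  qed
  show "p * q \<in> mpols_in V"
    unfolding mpols_in_iff
  proof (intro allI impI)
    fix m i assume "Poly_Mapping.lookup (p * q) m \<noteq> 0" "i \<notin> V"
    then obtain a b where "m = a + b" "Poly_Mapping.lookup p a \<noteq> 0" "Poly_Mapping.lookup q b \<noteq> 0"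
      using keys_mult[of p q] by (auto simp: in_keys_iff subset_iff)
    with pq \<open>i \<notin> V\<close> show "Poly_Mapping.lookup m i = 0"
      unfolding mpols_in_iff by (simp add: lookup_add)
  qed
qed

lemma pvar_power: "pvar i ^ k = Poly_Mapping.single (Poly_Mapping.single i k) 1"
  by (induction k) (auto simp: pvar_def mult_single simp flip: single_add)

lemma prod_single:
  "finite I \<Longrightarrow> (\<Prod>i\<in>I. Poly_Mapping.single (a i) (1 :: 'r::comm_semiring_1)) =
    Poly_Mapping.single (\<Sum>i\<in>I. a i :: 'a::comm_monoid_add) 1"
  by (induction rule: finite_induct) (auto simp: mult_single)

lemma sum_single_lookup:
  "(\<Sum>i\<in>UNIV. Poly_Mapping.single i (Poly_Mapping.lookup m i)) = (m :: 'n::finite \<Rightarrow>\<^sub>0 nat)"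
  by (rule poly_mapping_eqI) (simp add: lookup_sum lookup_single when_def)

lemma single_eq_prod_pvar:
  "Poly_Mapping.single m c = Poly_Mapping.single 0 c * (\<Prod>i\<in>UNIV. pvar i ^ Poly_Mapping.lookup m i)"
  by (simp add: pvar_power prod_single sum_single_lookup mult_single)

lemma mpol_as_sum: "p = (\<Sum>m\<in>Poly_Mapping.keys p. Poly_Mapping.single m (Poly_Mapping.lookup p m))"
  by (rule poly_mapping_eqI) (auto simp: lookup_sum lookup_single when_def in_keys_iff)

text \<open>
  The polynomials in the variables from \<open>V\<close> form the smallest subring containing the constants and
  these variables; this is how statements about all of them are reduced to the generators.
\<close>

lemma mpols_in_least:
  assumes B: "subdomain B"
    and const: "\<And>c. Poly_Mapping.single 0 c \<in> B" and var: "\<And>i. i \<in> V \<Longrightarrow> pvar i \<in> B"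
  shows "mpols_in V \<subseteq> (B :: ('r::idom, 'n::{finite,linorder}) mpol set)"
proof
  interpret subdomain B by fact
  fix p :: "('r, 'n) mpol" assume p: "p \<in> mpols_in V"
  have "Poly_Mapping.single m (Poly_Mapping.lookup p m) \<in> B" if "m \<in> Poly_Mapping.keys p" for m
  proof -
    have "pvar i ^ Poly_Mapping.lookup m i \<in> B" for i
      using p that var by (cases "i \<in> V") (auto simp: mpols_in_iff in_keys_iff intro: power_mem one_mem)
    then show ?thesis
      unfolding single_eq_prod_pvar[of m] by (intro mult_mem const prod_mem)
  qed
  then have "(\<Sum>m\<in>Poly_Mapping.keys p. Poly_Mapping.single m (Poly_Mapping.lookup p m)) \<in> B"
    by (rule sum_mem)
  then show "p \<in> B"
    by (simp flip: mpol_as_sum)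
qed

text \<open>
  The variable \<open>i\<close> is transcendental over the polynomials in the other variables: the monomials of
  the \<open>j\<close>-th summand of \<open>poly q (pvar i)\<close> have degree exactly \<open>j\<close> in \<open>i\<close>, so different summands
  cannot cancel.
\<close>

lemma mpols_in_insert_embedding:
  assumes "i \<notin> V"
  shows "subdomain_embedding (polys_over (mpols_in V))
    (\<lambda>q. poly q (pvar i :: ('r::idom, 'n::{finite,linorder}) mpol))"
proof (intro subdomain_embedding.intro subdomain_embedding_axioms.intro
    subdomain.polys_over_subdomain mpols_in_subdomain)
  let ?x = "pvar i :: ('r, 'n) mpol"
  interpret polys: subdomain "polys_over (mpols_in V :: ('r, 'n) mpol set)"
    by (intro subdomain.polys_over_subdomain mpols_in_subdomain)
  have zero: "q = 0" if q: "q \<in> polys_over (mpols_in V)" and "poly q ?x = 0" for q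
  proof -
    let ?t = "\<lambda>j. Polynomial.coeff q j * ?x ^ j"
    have degree_i: "Poly_Mapping.lookup m i = j" if "Poly_Mapping.lookup (?t j) m \<noteq> 0" for j m
    proof -
      from that obtain a b where ab: "m = a + b" "Poly_Mapping.lookup (Polynomial.coeff q j) a \<noteq> 0"
        "Poly_Mapping.lookup (?x ^ j) b \<noteq> 0"
        using keys_mult[of "Polynomial.coeff q j" "?x ^ j"] by (auto simp: in_keys_iff subset_iff)
      have "Poly_Mapping.lookup a i = 0"
        using q ab(2) assms unfolding polys_over_def mpols_in_iff by blast
      moreover have "b = Poly_Mapping.single i j"
        using ab(3) by (auto simp: pvar_power lookup_single when_def split: if_splits)
      ultimately show ?thesis
        using ab(1) by (simp add: lookup_add)
    qed
    have "?t j = 0" if "j \<le> degree q" for j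
    proof (rule poly_mapping_eqI)
      fix m
      show "Poly_Mapping.lookup (?t j) m = Poly_Mapping.lookup 0 m"
      proof (cases "Poly_Mapping.lookup m i = j")
        case True
        have "0 = (\<Sum>k\<le>degree q. Poly_Mapping.lookup (?t k) m)"
          using \<open>poly q ?x = 0\<close> by (simp add: poly_altdef flip: lookup_sum)
        also have "\<dots> = (\<Sum>k\<in>{j}. Poly_Mapping.lookup (?t k) m)"
          using True degree_i that by (intro sum.mono_neutral_right) auto
        finally show ?thesis
          by simp
      qed (use degree_i in auto)
    qed
    moreover have "?x ^ j \<noteq> 0" for j
      by (metis pvar_power lookup_single_eq lookup_zero one_neq_zero)
    ultimately have "lead_coeff q = 0"
      by (metis le_refl mult_eq_0_iff)
    then show "q = 0"
      by simp
  qed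
  show "inj_on (\<lambda>q. poly q ?x) (polys_over (mpols_in V))"
  proof (rule inj_onI)
    fix f g assume fg: "f \<in> polys_over (mpols_in V)" "g \<in> polys_over (mpols_in V)"
      "poly f ?x = poly g ?x"
    then have "f - g = 0"
      by (intro zero polys.diff_mem) auto
    then show "f = g"
      by simp
  qed
qed auto

lemma mpols_in_insert:
  assumes "i \<notin> V"
  shows "mpols_in (insert i V) =
    (\<lambda>q. poly q (pvar i :: ('r::idom, 'n::{finite,linorder}) mpol)) ` polys_over (mpols_in V)"
    (is "?L = ?R")
proof
  interpret V: subdomain "mpols_in V :: ('r, 'n) mpol set"
    by (rule mpols_in_subdomain)
  interpret emb: subdomain_embedding "polys_over (mpols_in V)"
    "\<lambda>q. poly q (pvar i :: ('r, 'n) mpol)"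
    using assms by (rule mpols_in_insert_embedding)
  show "?L \<subseteq> ?R"
  proof (rule mpols_in_least[OF emb.subdomain_image])
    have const: "a \<in> ?R" if "a \<in> mpols_in V" for a
      using that by (intro image_eqI[of _ _ "[:a:]"]) (auto simp: V.const_polys_over)
    show "Poly_Mapping.single 0 c \<in> ?R" for c
      by (intro const const_mem_mpols_in)
    have "pvar i \<in> ?R"
      using V.monom_polys_over[OF V.one_mem, of 1]
      by (intro image_eqI[of _ _ "Polynomial.monom 1 1"]) (auto simp: poly_monom)
    then show "pvar j \<in> ?R" if "j \<in> insert i V" for j
      using that by (auto intro: const pvar_mem_mpols_in)
  qed
  interpret iV: subdomain "mpols_in (insert i V) :: ('r, 'n) mpol set"
    by (rule mpols_in_subdomain)
  have "Polynomial.coeff q j \<in> mpols_in (insert i V)" if "q \<in> polys_over (mpols_in V)" for q j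
    using that by (auto simp: polys_over_def mpols_in_def)
  then show "?R \<subseteq> ?L"
    by (auto simp: poly_altdef intro!: iV.sum_mem iV.mult_mem iV.power_mem pvar_mem_mpols_in)
qed

lemma factorial_mpols_in:
  assumes "factorial_subdomain (UNIV :: 'r::idom set)"
  shows "factorial_subdomain (mpols_in V :: ('r, 'n::{finite,linorder}) mpol set)"
  using finite[of V]
proof (induction rule: finite_induct)
  case empty
  interpret subdomain_embedding UNIV "Poly_Mapping.single 0 :: 'r \<Rightarrow> ('r, 'n) mpol"
    by (intro subdomain_embedding.intro UNIV_subdomain subdomain_embedding_axioms.intro)
      (auto simp: mult_single single_diff)
  have "mpols_in {} \<subseteq> range (Poly_Mapping.single 0 :: 'r \<Rightarrow> ('r, 'n) mpol)"
    by (rule mpols_in_least[OF subdomain_image]) auto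
  then have "mpols_in {} = range (Poly_Mapping.single 0 :: 'r \<Rightarrow> ('r, 'n) mpol)"
    using const_mem_mpols_in by blast
  with factorial_image[OF assms] show ?case
    by simp
next
  case (insert i V)
  show ?case
    unfolding mpols_in_insert[OF insert.hyps(2)]
    using insert.IH insert.hyps(2)
    by (intro subdomain_embedding.factorial_image mpols_in_insert_embedding
        factorial_subdomain.factorial_polys_over)
qed

lemma factorial_mpol:
  assumes "factorial_subdomain (UNIV :: 'r::idom set)"
  shows "factorial_subdomain (UNIV :: ('r, 'n::{finite,linorder}) mpol set)"
  using factorial_mpols_in[OF assms, of UNIV] by (simp add: mpols_in_UNIV)

lemma (in subdomain) variable_prime_in_polys: "prime_in (polys_over A) (Polynomial.monom 1 1)"
proof -
  let ?X = "Polynomial.monom (1::'a) 1"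
  have dvd: "dvd_in (polys_over A) ?X f \<longleftrightarrow> Polynomial.coeff f 0 = 0"
    if "f \<in> polys_over A" for f
  proof
    assume f0: "Polynomial.coeff f 0 = 0"
    obtain a g where f: "f = pCons a g"
      by (cases f)
    have "Polynomial.coeff g i \<in> A" for i
      using that f unfolding polys_over_def by (metis coeff_pCons_Suc mem_Collect_eq)
    moreover have "f = ?X * g"
      using f f0 by (simp add: monom_altdef)
    ultimately show "dvd_in (polys_over A) ?X f"
      by (auto simp: dvd_in_def polys_over_def)
  qed (auto simp: dvd_in_def coeff_mult)
  interpret polys: subdomain "polys_over A"
    by (rule polys_over_subdomain)
  have "?X \<notin> units_in (polys_over A)"
    by (auto simp: units_polys_over monom_altdef)
  moreover have "dvd_in (polys_over A) ?X f \<or> dvd_in (polys_over A) ?X g"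
    if "f \<in> polys_over A" "g \<in> polys_over A" "dvd_in (polys_over A) ?X (f * g)" for f g
    using that(3) unfolding dvd[OF that(1)] dvd[OF that(2)] dvd[OF polys.mult_mem[OF that(1,2)]]
    by (simp add: coeff_mult)
  ultimately show ?thesis
    unfolding prime_in_def using monom_polys_over[OF one_mem] by auto
qed

text \<open>
  A variable is the indeterminate of a univariate polynomial ring over the polynomials in the other
  variables.
\<close>

lemma pvar_prime: "prime_in UNIV (pvar i :: ('r::idom, 'n::{finite,linorder}) mpol)"
proof -
  have "i \<notin> UNIV - {i}"
    by simp
  from subdomain_embedding.prime_in_image[OF mpols_in_insert_embedding[OF this]
      subdomain.variable_prime_in_polys[OF mpols_in_subdomain]]
  show ?thesis
    unfolding mpols_in_insert[OF \<open>i \<notin> UNIV - {i}\<close>, symmetric]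
    by (simp add: poly_monom insert_absorb mpols_in_UNIV)
qed

section \<open>Substituting into polynomials\<close>

lemma pvar_nonzero: "pvar i \<noteq> 0"
  using prime_inD(2)[OF pvar_prime] .

lemma of_mpol_add: "of_mpol (p + q) = of_mpol p + of_mpol q"
  by (simp add: of_mpol_def)

lemma of_mpol_mult: "of_mpol (p * q) = of_mpol p * of_mpol q"
  by (simp add: of_mpol_def)

lemma of_mpol_0: "of_mpol 0 = 0"
  by (simp add: of_mpol_def Zero_fract_def)

lemma of_mpol_1: "of_mpol 1 = 1"
  by (simp add: of_mpol_def One_fract_def)

lemma of_mpol_power: "of_mpol (p ^ n) = of_mpol p ^ n"
  by (induction n) (simp_all add: of_mpol_1 of_mpol_mult)

lemma of_mpol_prod: "of_mpol (prod f I) = (\<Prod>i\<in>I. of_mpol (f i))"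
  by (induction I rule: infinite_finite_induct) (simp_all add: of_mpol_1 of_mpol_mult)

lemma of_mpol_divide: "of_mpol p / of_mpol q = Fraction_Field.Fract p q"
  by (simp add: of_mpol_def)

lemma const_add: "const (a + b) = const a + const b"
  by (simp add: const_def single_add of_mpol_add)

lemma const_mult: "const (a * b) = const a * const b"
  by (simp add: const_def mult_single flip: of_mpol_mult)

lemma const_0: "const 0 = 0"
  by (simp add: const_def of_mpol_0)

lemma const_1: "const 1 = 1"
  by (simp add: const_def of_mpol_1)

lemma mpol_eval_superset:
  assumes "finite M" "Poly_Mapping.keys p \<subseteq> M"
  shows "mpol_eval v p = (\<Sum>m\<in>M. const (Poly_Mapping.lookup p m) *
    (\<Prod>i\<in>UNIV. v i ^ Poly_Mapping.lookup m i))"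
  unfolding mpol_eval_def
  using assms by (intro sum.mono_neutral_left) (auto simp: in_keys_iff const_0)

lemma mpol_eval_add: "mpol_eval v (p + q) = mpol_eval v p + mpol_eval v q"
proof -
  let ?M = "Poly_Mapping.keys p \<union> Poly_Mapping.keys q"
  have "mpol_eval v (p + q) = (\<Sum>m\<in>?M. const (Poly_Mapping.lookup (p + q) m) *
      (\<Prod>i\<in>UNIV. v i ^ Poly_Mapping.lookup m i))"
    by (intro mpol_eval_superset keys_add) auto
  then show ?thesis
    using mpol_eval_superset[of ?M p v] mpol_eval_superset[of ?M q v]
    by (simp add: lookup_add const_add distrib_right sum.distrib)
qed

lemma mpol_eval_0: "mpol_eval v 0 = 0"
  by (simp add: mpol_eval_def)

lemma mpol_eval_diff: "mpol_eval v (p - q) = mpol_eval v p - mpol_eval v q"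
  using mpol_eval_add[of v "p - q" q] by simp

lemma mpol_eval_sum: "mpol_eval v (sum f I) = (\<Sum>i\<in>I. mpol_eval v (f i))"
  by (induction I rule: infinite_finite_induct) (simp_all add: mpol_eval_0 mpol_eval_add)

lemma mpol_eval_single:
  "mpol_eval v (Poly_Mapping.single m c) = const c * (\<Prod>i\<in>UNIV. v i ^ Poly_Mapping.lookup m i)"
  by (subst mpol_eval_superset[of "{m}"]) auto

lemma mpol_eval_const: "mpol_eval v (Poly_Mapping.single 0 c) = const c"
  by (simp add: mpol_eval_single)

lemma mpol_eval_1: "mpol_eval v 1 = 1"
  using mpol_eval_const[of v 1] by (simp add: const_1)

lemma mpol_eval_pvar: "mpol_eval v (pvar i) = v i"
proof -
  have "(\<Prod>j\<in>UNIV. v j ^ Poly_Mapping.lookup (Poly_Mapping.single i (1::nat)) j) =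
      (\<Prod>j\<in>UNIV. if j = i then v j else 1)"
    by (intro prod.cong) (auto simp: lookup_single when_def)
  then show ?thesis
    by (simp add: pvar_def mpol_eval_single const_1)
qed

lemma mpol_eval_mult: "mpol_eval v (p * q) = mpol_eval v p * mpol_eval v q"
proof -
  let ?s = "\<lambda>p m. Poly_Mapping.single m (Poly_Mapping.lookup p m)"
  have single: "mpol_eval v (Poly_Mapping.single a b * Poly_Mapping.single c d) =
      mpol_eval v (Poly_Mapping.single a b) * mpol_eval v (Poly_Mapping.single c d)" for a b c d
    by (simp add: mult_single mpol_eval_single const_mult lookup_add power_add prod.distrib)
  have "mpol_eval v ((\<Sum>m\<in>Poly_Mapping.keys p. ?s p m) * (\<Sum>m\<in>Poly_Mapping.keys q. ?s q m)) =
      mpol_eval v (\<Sum>m\<in>Poly_Mapping.keys p. ?s p m) * mpol_eval v (\<Sum>m\<in>Poly_Mapping.keys q. ?s q m)"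
    by (simp only: sum_product mpol_eval_sum single)
  then show ?thesis
    by (simp flip: mpol_as_sum)
qed

lemma mpol_eval_power: "mpol_eval v (p ^ n) = mpol_eval v p ^ n"
  by (induction n) (simp_all add: mpol_eval_1 mpol_eval_mult)

lemma mpol_eval_prod: "mpol_eval v (prod f I) = (\<Prod>i\<in>I. mpol_eval v (f i))"
  by (induction I rule: infinite_finite_induct) (simp_all add: mpol_eval_1 mpol_eval_mult)

lemma mpol_eval_poly:
  "mpol_eval v (poly q t) = (\<Sum>j\<le>degree q. mpol_eval v (Polynomial.coeff q j) * mpol_eval v t ^ j)"
  by (simp add: poly_altdef mpol_eval_sum mpol_eval_mult mpol_eval_power)

lemma mpol_eval_cong:
  assumes "p \<in> mpols_in V" "\<And>i. i \<in> V \<Longrightarrow> v i = w i"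
  shows "mpol_eval v p = mpol_eval w p"
proof -
  have "mpols_in V \<subseteq> {p. mpol_eval v p = mpol_eval w p}"
    by (intro mpols_in_least subdomain.intro)
      (auto simp: mpol_eval_1 mpol_eval_diff mpol_eval_mult mpol_eval_const mpol_eval_pvar assms)
  with assms(1) show ?thesis
    by blast
qed

lemma mpol_eval_embedding:
  assumes "alg_independent x"
  shows "subdomain_embedding UNIV (mpol_eval x)"
proof (intro subdomain_embedding.intro UNIV_subdomain subdomain_embedding_axioms.intro)
  show "inj (mpol_eval x)"
  proof (rule injI)
    fix p q assume "mpol_eval x p = mpol_eval x q"
    then have "mpol_eval x (p - q) = 0"
      by (simp add: mpol_eval_diff)
    with assms have "p - q = 0"
      by (simp only: alg_independent_def)
    then show "p = q"
      by simp
  qed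
qed (simp_all add: mpol_eval_1 mpol_eval_diff mpol_eval_mult)

lemma alg_independent_nonzero: "alg_independent x \<Longrightarrow> x i \<noteq> 0"
  using pvar_nonzero mpol_eval_pvar[of x i] unfolding alg_independent_def by metis

text \<open>
  Algebraic independence keeps every denominator nonzero under the substitution, so any fraction that
  represents the rational function yields the same value.
\<close>

lemma ratfun_subst_divide:
  assumes "alg_independent x" "q \<noteq> 0"
  shows "ratfun_subst x (of_mpol p / of_mpol q) = mpol_eval x p / mpol_eval x q"
  unfolding ratfun_subst_def of_mpol_divide
proof (rule the_equality)
  have nz: "mpol_eval x q \<noteq> 0" if "q \<noteq> 0" for q
    using assms(1) that unfolding alg_independent_def by blast
  show "\<exists>p' q'. q' \<noteq> 0 \<and> Fraction_Field.Fract p q = Fraction_Field.Fract p' q' \<and>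
      mpol_eval x q' \<noteq> 0 \<and> mpol_eval x p / mpol_eval x q = mpol_eval x p' / mpol_eval x q'"
    using assms(2) nz by blast
  fix g assume "\<exists>p' q'. q' \<noteq> 0 \<and> Fraction_Field.Fract p q = Fraction_Field.Fract p' q' \<and>
      mpol_eval x q' \<noteq> 0 \<and> g = mpol_eval x p' / mpol_eval x q'"
  then obtain p' q' where g: "q' \<noteq> 0" "Fraction_Field.Fract p q = Fraction_Field.Fract p' q'"
    "mpol_eval x q' \<noteq> 0" "g = mpol_eval x p' / mpol_eval x q'"
    by blast
  then have "p * q' = p' * q"
    using assms(2) by (simp add: eq_fract)
  then have "mpol_eval x p * mpol_eval x q' = mpol_eval x p' * mpol_eval x q"
    by (simp flip: mpol_eval_mult)
  then show "g = mpol_eval x p / mpol_eval x q"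
    using g nz[OF assms(2)] by (simp add: frac_eq_eq)
qed

lemma mutated_cluster_eq:
  assumes "alg_independent x"
  shows "mutated_cluster k (x, F) = x(k := mpol_eval x (F k) /
    mpol_eval x (\<Prod>j\<in>UNIV - {k}. pvar j ^ exch_exponent F k j) / x k)"
proof -
  let ?q = "\<Prod>j\<in>UNIV - {k}. pvar j ^ exch_exponent F k j"
  have "exch_laurent F k = of_mpol (F k) / of_mpol ?q"
    by (simp add: exch_laurent_def xvar_def of_mpol_prod of_mpol_power)
  moreover have "?q \<noteq> 0"
    by (simp add: pvar_nonzero)
  ultimately have "ratfun_subst x (exch_laurent F k) = mpol_eval x (F k) / mpol_eval x ?q"
    using ratfun_subst_divide[OF assms, of ?q "F k"] by simp
  then show ?thesis
    by (simp add: mutated_cluster_def)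
qed

text \<open>
  A relation for the new element, cleared of denominators, is a relation for \<open>x\<close>: multiplied by the
  \<open>d\<close>-th power of \<open>m x\<^sub>k\<close>, where \<open>d\<close> is the degree of the relation in the new element, the term
  of degree \<open>j\<close> becomes a multiple of \<open>x\<^sub>k\<close> to the power \<open>d - j\<close>.
\<close>

lemma alg_independent_exchange:
  assumes x: "alg_independent x"
    and f: "f \<in> mpols_in (UNIV - {k})" "f \<noteq> 0" and m: "m \<in> mpols_in (UNIV - {k})" "m \<noteq> 0"
  shows "alg_independent (x(k := mpol_eval x f / mpol_eval x m / x k))" (is "alg_independent ?x'")
  unfolding alg_independent_def
proof (intro allI impI)
  let ?V = "UNIV - {k}"
  let ?y = "mpol_eval x f / mpol_eval x m / x k"
  fix p assume p: "mpol_eval ?x' p = 0"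
  interpret V: subdomain "mpols_in ?V :: ('b, 'a) mpol set"
    by (rule mpols_in_subdomain)
  interpret emb: subdomain_embedding "polys_over (mpols_in ?V)"
    "\<lambda>q. poly q (pvar k :: ('b, 'a) mpol)"
    by (rule mpols_in_insert_embedding) simp
  have "p \<in> mpols_in (insert k ?V)"
    by (simp add: mpols_in_UNIV insert_absorb)
  then obtain q where q: "q \<in> polys_over (mpols_in ?V)" "p = poly q (pvar k)"
    by (subst (asm) mpols_in_insert) auto
  let ?d = "degree q"
  \<comment> \<open>Multiplying the relation \<open>q\<close> for \<open>?y\<close> by the \<open>?d\<close>-th power of \<open>m x\<^sub>k\<close> gives the relation \<open>r\<close> for \<open>x\<^sub>k\<close>.\<close>
  define r where "r = (\<Sum>j\<le>?d. Polynomial.monom (Polynomial.coeff q j * f ^ j * m ^ (?d - j)) (?d - j))"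
  have coeffs: "Polynomial.coeff q j \<in> mpols_in ?V" for j
    using q(1) by (simp add: polys_over_def)
  have r: "r \<in> polys_over (mpols_in ?V)"
    unfolding r_def
    by (intro emb.sum_mem V.monom_polys_over V.mult_mem V.power_mem coeffs f m)
  have nz: "x k \<noteq> 0" "mpol_eval x m \<noteq> 0"
    using x m(2) alg_independent_nonzero unfolding alg_independent_def by blast+
  let ?z = "mpol_eval x m * x k"
  have "(\<Sum>j\<le>?d. mpol_eval x (Polynomial.coeff q j) * ?y ^ j) = mpol_eval ?x' p"
    unfolding q(2) mpol_eval_poly
    using mpol_eval_cong[OF coeffs, of x ?x'] by (simp add: mpol_eval_pvar)
  then have "0 = ?z ^ ?d * (\<Sum>j\<le>?d. mpol_eval x (Polynomial.coeff q j) * ?y ^ j)"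
    using p by simp
  also have "\<dots> = (\<Sum>j\<le>?d. mpol_eval x (Polynomial.coeff q j) * (?z ^ ?d * ?y ^ j))"
    by (simp add: sum_distrib_left mult.left_commute)
  also have "\<dots> = (\<Sum>j\<le>?d. mpol_eval x (Polynomial.coeff q j) * (mpol_eval x f ^ j * ?z ^ (?d - j)))"
  proof (rule sum.cong[OF refl])
    fix j assume "j \<in> {..?d}"
    then have "?z ^ ?d = ?z ^ j * ?z ^ (?d - j)"
      by (simp only: atMost_iff le_add_diff_inverse flip: power_add)
    then have "?z ^ ?d * ?y ^ j = (?z * ?y) ^ j * ?z ^ (?d - j)"
      unfolding power_mult_distrib[of ?z ?y] by (simp only: ac_simps)
    also have "?z * ?y = mpol_eval x f"
      using nz by simp
    finally show "mpol_eval x (Polynomial.coeff q j) * (?z ^ ?d * ?y ^ j) =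
        mpol_eval x (Polynomial.coeff q j) * (mpol_eval x f ^ j * ?z ^ (?d - j))"
      by (rule arg_cong)
  qed
  also have "\<dots> = mpol_eval x (poly r (pvar k))"
    by (simp add: r_def poly_sum poly_monom mpol_eval_sum mpol_eval_mult mpol_eval_power
        mpol_eval_pvar power_mult_distrib ac_simps)
  finally have "poly r (pvar k) = 0"
    using x unfolding alg_independent_def by metis
  then have "r = 0"
    using emb.hom_eq_iff[OF r emb.zero_mem] by simp
  \<comment> \<open>The constant coefficient of \<open>r\<close> comes from the leading coefficient of \<open>q\<close>.\<close>
  have "Polynomial.coeff r 0 = (\<Sum>j\<le>?d. if j = ?d then lead_coeff q * f ^ ?d else 0)"
    unfolding r_def coeff_sum by (intro sum.cong) (auto simp: coeff_monom)
  with \<open>r = 0\<close> f(2) have "q = 0"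
    by simp
  with q(2) show "p = 0"
    by simp
qed

section \<open>Localization and orders at a prime\<close>

definition localization :: "'f::field set \<Rightarrow> 'f set \<Rightarrow> 'f set" where
  "localization A S = {a / s | a s. a \<in> A \<and> s \<in> S}"

locale denominators = factorial_subdomain A for A :: "'f::field set" +
  fixes S :: "'f set"
  assumes S_sub: "S \<subseteq> A" and S_nonzero: "0 \<notin> S"
    and S_one: "1 \<in> S" and S_mult: "s \<in> S \<Longrightarrow> t \<in> S \<Longrightarrow> s * t \<in> S"
begin

lemma localizationI: "a \<in> A \<Longrightarrow> s \<in> S \<Longrightarrow> a / s \<in> localization A S"
  by (auto simp: localization_def)

lemma localization_superset: "a \<in> A \<Longrightarrow> a \<in> localization A S"
  using localizationI[OF _ S_one] by simp

lemma localization_subdomain: "subdomain (localization A S)"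
proof
  show "1 \<in> localization A S"
    by (intro localization_superset one_mem)
  fix f g assume "f \<in> localization A S" "g \<in> localization A S"
  then obtain a s b t where f: "a \<in> A" "s \<in> S" "f = a / s" and g: "b \<in> A" "t \<in> S" "g = b / t"
    by (auto simp: localization_def)
  have "s \<in> A" "t \<in> A" "s \<noteq> 0" "t \<noteq> 0"
    using f g S_sub S_nonzero by auto
  then have "f - g = (a * t - b * s) / (s * t)" "f * g = (a * b) / (s * t)"
    using f g by (auto simp: field_simps)
  then show "f - g \<in> localization A S" "f * g \<in> localization A S"
    using f g \<open>s \<in> A\<close> \<open>t \<in> A\<close> by (auto intro!: localizationI diff_mem mult_mem S_mult)
qed

lemma dvd_localization:
  assumes "p \<in> A" "a \<in> A" "s \<in> S" "dvd_in (localization A S) p (a / s)"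
  obtains t where "t \<in> S" "dvd_in A p (a * t)"
proof -
  obtain b t where b: "b \<in> A" "t \<in> S" "a / s = p * (b / t)"
    using assms(4) by (auto simp: dvd_in_def localization_def)
  have "s \<noteq> 0" "t \<noteq> 0"
    using assms(3) b(2) S_nonzero by auto
  then have "a * t = p * (b * s)"
    using b(3) by (simp add: field_simps)
  then have "dvd_in A p (a * t)"
    using b(1) assms(3) S_sub by (intro dvd_inI[of _ _ "b * s"] mult_mem) auto
  with b(2) that show thesis
    by blast
qed

text \<open>
  A prime that divides no denominator can be cancelled against all of them, so divisibility by it is
  already decided by numerators.
\<close>

lemma prime_in_localization:
  assumes p: "prime_in A p" and S: "\<And>s. s \<in> S \<Longrightarrow> \<not> dvd_in A p s"
  shows "prime_in (localization A S) p"
proof -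
  have pA: "p \<in> A" "p \<noteq> 0"
    using p by (auto simp: prime_in_def)
  have dvd: "dvd_in A p a" if as: "a \<in> A" "s \<in> S" "dvd_in (localization A S) p (a / s)" for a s
  proof -
    obtain t where "t \<in> S" "dvd_in A p (a * t)"
      by (rule dvd_localization[OF pA(1) as])
    then show ?thesis
      using prime_inD(4)[OF p as(1), of t] S S_sub by auto
  qed
  have "p \<notin> units_in (localization A S)"
  proof
    assume "p \<in> units_in (localization A S)"
    then have "dvd_in (localization A S) p (1 / 1)"
      by (auto simp: units_in_def dvd_in_def)
    then show False
      using dvd[OF one_mem S_one] S[OF S_one] by simp
  qed
  moreover have "dvd_in (localization A S) p f \<or> dvd_in (localization A S) p g"
    if fg: "f \<in> localization A S" "g \<in> localization A S" "dvd_in (localization A S) p (f * g)" for f g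
  proof -
    obtain a s b t where f: "a \<in> A" "s \<in> S" "f = a / s" and g: "b \<in> A" "t \<in> S" "g = b / t"
      using fg by (auto simp: localization_def)
    have "dvd_in A p (a * b)"
      using fg(3) f g by (intro dvd[OF mult_mem S_mult, of a b s t]) simp_all
    moreover have "dvd_in (localization A S) p (c / u)" if "dvd_in A p c" "u \<in> S" for c u
    proof -
      obtain c' where "c' \<in> A" "c = p * c'"
        using \<open>dvd_in A p c\<close> by (auto simp: dvd_in_def)
      then show ?thesis
        using that(2) by (intro dvd_inI[of _ _ "c' / u"] localizationI) auto
    qed
    ultimately show ?thesis
      using prime_inD(4)[OF p f(1) g(1)] f g by blast
  qed
  ultimately show ?thesis
    unfolding prime_in_def using pA by (auto intro: localization_superset)
qed

lemma factorial_localization: "factorial_subdomain (localization A S)"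
proof (intro factorial_subdomain.intro localization_subdomain factorial_subdomain_axioms.intro)
  let ?L = "localization A S"
  interpret L: subdomain ?L
    by (rule localization_subdomain)
  have units: "a / s \<in> units_in ?L" if "a \<in> units_in A \<or> (\<exists>t\<in>S. dvd_in A a t)" "a \<in> A" "s \<in> S" for a s
  proof -
    have "\<exists>t\<in>S. dvd_in A a t"
      using that(1)
    proof
      assume "a \<in> units_in A"
      then have "dvd_in A a 1"
        by (auto simp: units_in_def dvd_in_def)
      with S_one show ?thesis ..
    qed
    then obtain t c where "t \<in> S" "c \<in> A" "t = a * c"
      by (auto simp: dvd_in_def)
    moreover have "t \<noteq> 0" "s \<noteq> 0" "s \<in> A"
      using \<open>t \<in> S\<close> \<open>s \<in> S\<close> S_nonzero S_sub by auto
    ultimately show ?thesis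
      unfolding units_in_def using that
      by (auto intro!: localizationI bexI[of _ "c * s / t"] mult_mem)
  qed
  \<comment> \<open>Primes dividing a denominator become units, and all other primes stay prime.\<close>
  have claim: "\<exists>u qs. u \<in> units_in ?L \<and> (\<forall>q\<in>set qs. prime_in ?L q) \<and> prod_list ps = u * prod_list qs"
    if "\<forall>p\<in>set ps. prime_in A p" for ps
    using that
  proof (induction ps)
    case Nil
    show ?case
      using L.one_units_in by (intro exI[of _ 1] exI[of _ "[]"]) auto
  next
    case (Cons p ps)
    then obtain u qs where u: "u \<in> units_in ?L" "\<forall>q\<in>set qs. prime_in ?L q" "prod_list ps = u * prod_list qs"
      by auto
    have p: "prime_in A p"
      using Cons.prems by simp
    show ?case
    proof (cases "\<exists>t\<in>S. dvd_in A p t")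
      case True
      then have "p \<in> units_in ?L"
        using units[of p 1] prime_inD(1)[OF p] S_one by simp
      then show ?thesis
        using u by (intro exI[of _ "p * u"] exI[of _ qs]) (auto intro: L.mult_units_in)
    next
      case False
      then have "prime_in ?L p"
        using prime_in_localization[OF p] by blast
      then show ?thesis
        using u by (intro exI[of _ u] exI[of _ "p # qs"]) auto
    qed
  qed
  fix f assume "f \<in> ?L" "f \<noteq> 0"
  then obtain a s where a: "a \<in> A" "s \<in> S" "f = a / s" "a \<noteq> 0"
    by (auto simp: localization_def)
  obtain u ps where u: "u \<in> units_in A" "\<forall>p\<in>set ps. prime_in A p" "a = u * prod_list ps"
    using prime_factorization[OF a(1,4)] by blast
  obtain w qs where w: "w \<in> units_in ?L" "\<forall>q\<in>set qs. prime_in ?L q" "prod_list ps = w * prod_list qs"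
    using claim[OF u(2)] by blast
  have "u / s \<in> units_in ?L"
    using u(1) a(2) units_inD(1)[OF u(1)] by (intro units) auto
  then have "u / s * w \<in> units_in ?L"
    using w(1) by (rule L.mult_units_in)
  moreover have "f = u / s * w * prod_list qs"
    using a(3) u(3) w(3) by simp
  ultimately show "\<exists>u qs. u \<in> units_in ?L \<and> (\<forall>q\<in>set qs. prime_in ?L q) \<and> f = u * prod_list qs"
    using w(2) by blast
qed

end

text \<open>
  The order at a prime \<open>q\<close> of a factorial ring \<open>D\<close> is defined on \<open>D[1/q]\<close>, called \<open>fractions\<close> below.
\<close>

locale prime_order = factorial_subdomain D for D :: "'f::field set" +
  fixes q :: 'f
  assumes q: "prime_in D q"
begin

definition order_at :: "'f \<Rightarrow> int" where
  "order_at f = (THE z. \<exists>g\<in>D. \<not> dvd_in D q g \<and> f = q powi z * g)"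

definition fractions :: "'f set" where
  "fractions = {f. \<exists>n. f * q ^ n \<in> D}"

lemma qD: "q \<in> D" "q \<noteq> 0"
  using q by (auto simp: prime_in_def)

lemma order_unique:
  assumes "g \<in> D" "\<not> dvd_in D q g" "h \<in> D" "\<not> dvd_in D q h" "q powi y * g = q powi z * h"
  shows "y = z"
proof -
  have False if "y < z" "g \<in> D" "h \<in> D" "\<not> dvd_in D q g" "q powi y * g = q powi z * h" for y z g h
  proof -
    have "z = y + 1 + int (nat (z - y - 1))"
      using \<open>y < z\<close> by simp
    then have "q powi z = q powi y * q * q ^ nat (z - y - 1)"
      using qD by (metis power_int_add power_int_1_right power_int_of_nat)
    then have "q powi y * g = q powi y * (q * (q ^ nat (z - y - 1) * h))"
      using that(5) by (simp add: mult.assoc)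
    then have "g = q * (q ^ nat (z - y - 1) * h)"
      using qD by simp
    then have "dvd_in D q g"
      by (rule dvd_inI) (intro mult_mem power_mem qD that(3))
    with that(4) show False ..
  qed
  from this[of y z g h] this[of z y h g] assms show ?thesis
    by (metis linorder_neqE)
qed

lemma order_at_eq:
  assumes "g \<in> D" "\<not> dvd_in D q g"
  shows "order_at (q powi z * g) = z"
  unfolding order_at_def
proof (rule the_equality)
  show "\<exists>h\<in>D. \<not> dvd_in D q h \<and> q powi z * g = q powi z * h"
    using assms by blast
qed (use assms order_unique in metis)

lemma order_exists:
  assumes "f \<in> fractions" "f \<noteq> 0"
  obtains g where "g \<in> D" "\<not> dvd_in D q g" "f = q powi order_at f * g"
proof -
  obtain n where "f * q ^ n \<in> D"
    using assms by (auto simp: fractions_def)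
  moreover have "f * q ^ n \<noteq> 0"
    using assms qD by simp
  ultimately obtain m g where g: "g \<in> D" "\<not> dvd_in D q g" "f * q ^ n = q ^ m * g"
    using prime_power_split[OF q] by metis
  then have "f = q powi (int m - int n) * g"
    using qD by (simp add: power_int_diff field_simps)
  with g that show thesis
    using order_at_eq by metis
qed

lemma order_at_mult:
  assumes "f \<in> fractions" "g \<in> fractions" "f \<noteq> 0" "g \<noteq> 0"
  shows "order_at (f * g) = order_at f + order_at g"
proof -
  obtain a where a: "a \<in> D" "\<not> dvd_in D q a" "f = q powi order_at f * a"
    using order_exists[OF assms(1,3)] .
  obtain b where b: "b \<in> D" "\<not> dvd_in D q b" "g = q powi order_at g * b"
    using order_exists[OF assms(2,4)] .
  have "f * g = q powi (order_at f + order_at g) * (a * b)"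
    by (subst a(3), subst b(3)) (simp add: power_int_add qD)
  moreover have "a * b \<in> D" "\<not> dvd_in D q (a * b)"
    using a b prime_inD(4)[OF q a(1) b(1)] by (auto intro: mult_mem)
  ultimately show ?thesis
    using order_at_eq by simp
qed

lemma order_at_nonneg_iff:
  assumes "f \<in> fractions" "f \<noteq> 0"
  shows "order_at f \<ge> 0 \<longleftrightarrow> f \<in> D"
proof
  obtain g where g: "g \<in> D" "\<not> dvd_in D q g" "f = q powi order_at f * g"
    using order_exists[OF assms] .
  assume "order_at f \<ge> 0"
  then have "f = q ^ nat (order_at f) * g"
    by (subst g(3)) (simp add: power_int_def)
  then show "f \<in> D"
    using g(1) qD by (metis mult_mem power_mem)
next
  assume "f \<in> D"
  then obtain m g where g: "g \<in> D" "\<not> dvd_in D q g" "f = q ^ m * g"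
    using prime_power_split[OF q] assms(2) by metis
  then show "order_at f \<ge> 0"
    using order_at_eq[of g "int m"] by simp
qed

lemma order_at_unit: "u \<in> units_in D \<Longrightarrow> order_at u = 0"
  using order_at_eq[of u 0] prime_not_dvd_unit[OF q] by (auto dest: units_inD)

lemma order_at_prime_mult_unit: "u \<in> units_in D \<Longrightarrow> order_at (q * u) = 1"
  using order_at_eq[of u 1] prime_not_dvd_unit[OF q] by (auto dest: units_inD)

lemma subset_fractions: "D \<subseteq> fractions"
  by (auto simp: fractions_def intro: exI[of _ 0])

lemma inverse_q_fractions: "inverse q \<in> fractions"
  using qD one_mem by (auto simp: fractions_def intro!: exI[of _ 1])

lemma fractions_subdomain: "subdomain fractions"
proof
  show "1 \<in> fractions"
    using subset_fractions one_mem by blast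
  fix f g assume "f \<in> fractions" "g \<in> fractions"
  then obtain m n where mn: "f * q ^ m \<in> D" "g * q ^ n \<in> D"
    by (auto simp: fractions_def)
  have "f * q ^ (m + n) \<in> D" "g * q ^ (m + n) \<in> D"
    using mult_mem[OF mn(1) power_mem[OF qD(1), of n]] mult_mem[OF mn(2) power_mem[OF qD(1), of m]]
    by (simp_all add: power_add ac_simps)
  then have "(f - g) * q ^ (m + n) \<in> D"
    by (metis diff_mem left_diff_distrib)
  then show "f - g \<in> fractions"
    by (auto simp: fractions_def)
  have "f * g * q ^ (m + n) \<in> D"
    using mult_mem[OF mn] by (simp add: power_add ac_simps)
  then show "f * g \<in> fractions"
    by (auto simp: fractions_def)
qed

end

section \<open>Factorial domains cut out by valuations\<close>

lemma prod_powers_as_prime_list: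
  assumes "finite I" "\<And>i. i \<in> I \<Longrightarrow> prime_in A (y i)"
  shows "\<exists>qs. (\<forall>q\<in>set qs. prime_in A q) \<and> (\<Prod>i\<in>I. y i ^ n i) = prod_list qs"
  using assms
proof (induction I rule: finite_induct)
  case empty
  show ?case
    by (intro exI[of _ "[]"]) simp
next
  case (insert i I)
  then obtain qs where "\<forall>q\<in>set qs. prime_in A q" "(\<Prod>i\<in>I. y i ^ n i) = prod_list qs"
    by auto
  with insert show ?case
    by (intro exI[of _ "replicate (n i) (y i) @ qs"]) (auto simp: prod_list_replicate)
qed

text \<open>
  The functions \<open>v i\<close> and the units \<open>y i\<close> are dual to each other, so that a monomial in the \<open>y i\<close> is
  determined by its values under the \<open>v i\<close>, which can be prescribed arbitrarily.
\<close>

locale dual_valuations = factorial_subdomain L for L :: "'f::field set" +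
  fixes v :: "'i::finite \<Rightarrow> 'f \<Rightarrow> int" and y :: "'i \<Rightarrow> 'f"
  assumes v_mult: "a \<in> L \<Longrightarrow> b \<in> L \<Longrightarrow> a \<noteq> 0 \<Longrightarrow> b \<noteq> 0 \<Longrightarrow> v i (a * b) = v i a + v i b"
    and y_unit: "y i \<in> units_in L"
    and v_y: "v i (y j) = (if i = j then 1 else 0)"
begin

definition nonneg :: "'f set" where
  "nonneg = {f \<in> L. f = 0 \<or> (\<forall>i. v i f \<ge> 0)}"

definition y_monom :: "('i \<Rightarrow> int) \<Rightarrow> 'f" where
  "y_monom e = (\<Prod>i\<in>UNIV. y i powi e i)"

text \<open>The representative of \<open>f\<close>, modulo monomials, on which all valuations vanish.\<close>

definition normal :: "'f \<Rightarrow> 'f" where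
  "normal f = f * y_monom (\<lambda>i. - v i f)"

lemma y_nonzero: "y i \<noteq> 0"
  using units_inD(2)[OF y_unit] .

lemma inverse_y: "inverse (y i) \<in> L"
proof -
  obtain z where z: "z \<in> units_in L" "y i * z = 1"
    by (rule units_inE[OF y_unit])
  then have "inverse (y i) = z"
    using y_nonzero by (simp add: field_simps)
  with z show ?thesis
    by (simp add: units_inD)
qed

lemma v_1: "v i 1 = 0"
  using v_mult[of 1 1 i] one_mem by simp

lemma v_inverse_y: "v i (inverse (y j)) = - v i (y j)"
  using v_mult[of "y j" "inverse (y j)" i] y_nonzero inverse_y units_inD(1)[OF y_unit]
  by (simp add: v_1)

lemma v_power:
  assumes "a \<in> L" "a \<noteq> 0"
  shows "v i (a ^ n) = int n * v i a"
  using assms by (induction n) (auto simp: v_1 v_mult power_mem algebra_simps)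

lemma y_powi_mem: "y i powi z \<in> L"
  by (auto simp: power_int_def intro!: power_mem inverse_y units_inD(1)[OF y_unit])

lemma v_y_powi: "v i (y j powi z) = (if i = j then z else 0)"
  using units_inD(1)[OF y_unit] inverse_y y_nonzero
  by (auto simp: power_int_def v_power v_inverse_y v_y)

lemma y_monom_mem: "y_monom e \<in> L"
  unfolding y_monom_def by (intro prod_mem y_powi_mem)

lemma y_monom_nonzero: "y_monom e \<noteq> 0"
  by (simp add: y_monom_def y_nonzero)

lemma y_monom_add: "y_monom (\<lambda>i. d i + e i) = y_monom d * y_monom e"
  by (simp add: y_monom_def power_int_add y_nonzero prod.distrib)

lemma y_monom_uminus: "y_monom (\<lambda>i. - e i) * y_monom e = 1"
  using y_monom_add[of "\<lambda>i. - e i" e] by (simp add: y_monom_def)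

lemma v_y_monom: "v i (y_monom e) = e i"
proof -
  have "(\<Prod>j\<in>J. y j powi e j) \<in> L \<and> (\<Prod>j\<in>J. y j powi e j) \<noteq> 0 \<and>
      v i (\<Prod>j\<in>J. y j powi e j) = (\<Sum>j\<in>J. if i = j then e j else 0)" if "finite J" for J
    using that
    by (induction J rule: finite_induct)
      (auto simp: v_1 one_mem v_mult y_powi_mem y_nonzero mult_mem v_y_powi)
  from this[of UNIV] show ?thesis
    by (simp add: y_monom_def)
qed

lemma normal_mem: "f \<in> L \<Longrightarrow> normal f \<in> L"
  unfolding normal_def by (intro mult_mem y_monom_mem)

lemma normal_nonzero: "f \<noteq> 0 \<Longrightarrow> normal f \<noteq> 0"
  by (simp add: normal_def y_monom_nonzero)

lemma v_normal: "f \<in> L \<Longrightarrow> f \<noteq> 0 \<Longrightarrow> v i (normal f) = 0"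
  by (simp add: normal_def v_mult y_monom_mem y_monom_nonzero v_y_monom)

lemma normal_mem_nonneg: "f \<in> L \<Longrightarrow> f \<noteq> 0 \<Longrightarrow> normal f \<in> nonneg"
  by (simp add: nonneg_def normal_mem v_normal)

lemma normal_mult:
  assumes "f \<in> L" "g \<in> L" "f \<noteq> 0" "g \<noteq> 0"
  shows "normal (f * g) = normal f * normal g"
  using assms y_monom_add[of "\<lambda>i. - v i f" "\<lambda>i. - v i g"]
  by (simp add: normal_def v_mult algebra_simps)

lemma eq_normal_mult: "f = normal f * y_monom (\<lambda>i. v i f)"
  using y_monom_uminus[of "\<lambda>i. v i f"] by (simp add: normal_def mult.assoc)

lemma nonneg_sub: "nonneg \<subseteq> L"
  by (auto simp: nonneg_def)

text \<open>
  Division by \<open>y i\<close> is possible in \<open>L\<close>; it lowers the \<open>i\<close>-th value by one and keeps the others.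
\<close>

lemma divide_y:
  assumes "f \<in> nonneg" "f = 0 \<or> v i f \<ge> 1"
  shows "dvd_in nonneg (y i) f"
proof (rule dvd_inI)
  show "f = y i * (f * inverse (y i))"
    using y_nonzero[of i] by simp
  show "f * inverse (y i) \<in> nonneg"
    using assms inverse_y y_nonzero
    by (auto simp: nonneg_def v_mult v_inverse_y v_y intro: mult_mem)
qed

lemma y_mem_nonneg: "y i \<in> nonneg"
  using units_inD(1)[OF y_unit] by (simp add: nonneg_def v_y)

lemma y_dvd_iff:
  assumes "f \<in> nonneg" "f \<noteq> 0"
  shows "dvd_in nonneg (y i) f \<longleftrightarrow> v i f \<ge> 1"
proof
  assume "dvd_in nonneg (y i) f"
  then obtain g where g: "g \<in> nonneg" "f = y i * g"
    by (auto simp: dvd_in_def)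
  with assms have "g \<noteq> 0"
    by auto
  with g show "v i f \<ge> 1"
    using y_nonzero units_inD(1)[OF y_unit] by (auto simp: nonneg_def v_mult v_y)
qed (use assms divide_y in auto)

lemma y_prime: "prime_in nonneg (y i)"
proof -
  have "y i \<notin> units_in nonneg"
  proof
    assume "y i \<in> units_in nonneg"
    then have "dvd_in nonneg (y i) 1"
      by (auto simp: units_in_def dvd_in_def)
    moreover have "1 \<in> nonneg"
      by (simp add: nonneg_def one_mem v_1)
    ultimately show False
      using y_dvd_iff[of 1 i] by (simp add: v_1)
  qed
  moreover have "dvd_in nonneg (y i) f \<or> dvd_in nonneg (y i) g"
    if fg: "f \<in> nonneg" "g \<in> nonneg" "dvd_in nonneg (y i) (f * g)" for f g
  proof (cases "f = 0 \<or> g = 0")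
    case True
    then show ?thesis
      using fg divide_y by blast
  next
    case False
    obtain h where h: "h \<in> nonneg" "f * g = y i * h"
      using fg(3) by (auto simp: dvd_in_def)
    have "y i * h \<noteq> 0"
      using False by (simp flip: h(2))
    then have "h \<noteq> 0"
      by auto
    then have "v i (y i * h) = 1 + v i h" "v i h \<ge> 0"
      using h(1) y_nonzero units_inD(1)[OF y_unit] by (auto simp: nonneg_def v_mult v_y)
    moreover have "v i (f * g) = v i f + v i g"
      using False fg nonneg_sub by (intro v_mult) auto
    ultimately have "v i f \<ge> 1 \<or> v i g \<ge> 1"
      unfolding h(2)
      by linarith
    then show ?thesis
      using fg divide_y by blast
  qed
  ultimately show ?thesis
    unfolding prime_in_def using y_mem_nonneg y_nonzero by blast
qed

text \<open>
  Dividing by \<open>normal p\<close> changes no value under the \<open>v i\<close>, so a quotient that exists in \<open>L\<close> is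
  nonnegative as soon as \<open>f\<close> is.
\<close>

lemma normal_dvd_iff:
  assumes "p \<in> L" "p \<noteq> 0" "f \<in> nonneg"
  shows "dvd_in nonneg (normal p) f \<longleftrightarrow> dvd_in L p f"
proof
  assume "dvd_in nonneg (normal p) f"
  then obtain g where "g \<in> nonneg" "f = normal p * g"
    by (auto simp: dvd_in_def)
  then show "dvd_in L p f"
    using nonneg_sub unfolding normal_def
    by (intro dvd_inI[of _ _ "y_monom (\<lambda>i. - v i p) * g"]) (auto intro: mult_mem y_monom_mem)
next
  assume "dvd_in L p f"
  then obtain g where g: "g \<in> L" "f = p * g"
    by (auto simp: dvd_in_def)
  define h where "h = y_monom (\<lambda>i. v i p) * g"
  have f: "f = normal p * h"
    using g(2) eq_normal_mult[of p] unfolding h_def by (metis mult.assoc)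
  have hL: "h \<in> L"
    unfolding h_def using g(1) by (intro mult_mem y_monom_mem)
  have "v i h = v i f" if "h \<noteq> 0" for i
    unfolding f using that hL assms by (simp add: v_mult normal_mem normal_nonzero v_normal)
  then have "h \<in> nonneg"
    using hL assms f normal_nonzero by (auto simp: nonneg_def)
  with f show "dvd_in nonneg (normal p) f"
    by (rule dvd_inI)
qed

lemma normal_prime:
  assumes p: "prime_in L p" and "subdomain nonneg"
  shows "prime_in nonneg (normal p)"
proof -
  interpret U: subdomain nonneg by fact
  have pL: "p \<in> L" "p \<noteq> 0"
    using p by (auto simp: prime_in_def)
  have "normal p \<notin> units_in nonneg"
  proof
    assume "normal p \<in> units_in nonneg"
    then have "dvd_in nonneg (normal p) 1"
      by (auto simp: units_in_def dvd_in_def)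
    then have "dvd_in L p 1"
      using normal_dvd_iff[OF pL U.one_mem] by simp
    then show False
      using prime_not_dvd_unit[OF p one_units_in] by simp
  qed
  moreover have "dvd_in nonneg (normal p) f \<or> dvd_in nonneg (normal p) g"
    if fg: "f \<in> nonneg" "g \<in> nonneg" "dvd_in nonneg (normal p) (f * g)" for f g
    using fg(3) prime_inD(4)[OF p] fg(1,2) nonneg_sub
    unfolding normal_dvd_iff[OF pL fg(1)] normal_dvd_iff[OF pL fg(2)]
      normal_dvd_iff[OF pL U.mult_mem[OF fg(1,2)]]
    by blast
  ultimately show ?thesis
    unfolding prime_in_def using normal_mem_nonneg normal_nonzero pL by blast
qed

lemma normal_prod_list:
  assumes "\<forall>p\<in>set ps. p \<in> L \<and> p \<noteq> 0"
  shows "normal (prod_list ps) = prod_list (map normal ps)"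
  using assms
proof (induction ps)
  case Nil
  show ?case
    by (simp add: normal_def v_1 y_monom_def)
next
  case (Cons p ps)
  have "prod_list ps \<in> L" "prod_list ps \<noteq> 0"
    using Cons.prems by (auto intro!: prod_list_mem simp: prod_list_zero_iff)
  with Cons show ?case
    by (simp add: normal_mult)
qed

lemma normal_unit:
  assumes "u \<in> units_in L"
  shows "normal u \<in> units_in nonneg"
proof -
  obtain w where w: "w \<in> units_in L" "u * w = 1"
    using assms by (rule units_inE)
  have uw: "u \<in> L" "u \<noteq> 0" "w \<in> L" "w \<noteq> 0"
    using assms w by (auto dest: units_inD)
  have "normal u * normal w = 1"
    using normal_mult[of u w] uw w normal_prod_list[of "[]"] by simp
  then show ?thesis
    unfolding units_in_def using uw normal_mem_nonneg by blast
qed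

text \<open>
  In a factorization of \<open>f\<close> in \<open>L\<close> every factor is replaced by its normal form; what is missing is
  the monomial with exponents \<open>v i f\<close>, which are nonnegative.
\<close>

theorem factorial_nonneg:
  assumes U: "subdomain nonneg"
  shows "factorial_subdomain nonneg"
proof (intro factorial_subdomain.intro U factorial_subdomain_axioms.intro)
  fix f assume "f \<in> nonneg" "f \<noteq> 0"
  then have f: "f \<in> L" "f \<noteq> 0" and v_f: "\<And>i. v i f \<ge> 0"
    by (auto simp: nonneg_def)
  obtain u ps where u: "u \<in> units_in L" "\<forall>p\<in>set ps. prime_in L p" "f = u * prod_list ps"
    using prime_factorization[OF f] by blast
  have ps: "\<forall>p\<in>set ps. p \<in> L \<and> p \<noteq> 0"
    using u(2) by (auto simp: prime_in_def)
  have "normal f = normal u * normal (prod_list ps)"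
    unfolding u(3) using u(1) ps
    by (intro normal_mult) (auto intro!: prod_list_mem simp: prod_list_zero_iff dest: units_inD)
  then have "normal f = normal u * prod_list (map normal ps)"
    using normal_prod_list[OF ps] by simp
  moreover obtain qs where qs: "\<forall>q\<in>set qs. prime_in nonneg q"
      "(\<Prod>i\<in>UNIV. y i ^ nat (v i f)) = prod_list qs"
    using prod_powers_as_prime_list[of UNIV nonneg y "\<lambda>i. nat (v i f)"] y_prime by auto
  moreover have "y_monom (\<lambda>i. v i f) = (\<Prod>i\<in>UNIV. y i ^ nat (v i f))"
    using v_f by (simp add: y_monom_def power_int_def)
  ultimately have "f = normal u * prod_list (map normal ps @ qs)"
    using eq_normal_mult[of f] by simp
  moreover have "\<forall>p\<in>set (map normal ps @ qs). prime_in nonneg p"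
    using qs(1) u(2) normal_prime[OF _ U] by auto
  ultimately show "\<exists>u ps. u \<in> units_in nonneg \<and> (\<forall>p\<in>set ps. prime_in nonneg p) \<and>
      f = u * prod_list ps"
    using normal_unit[OF u(1)] by blast
qed

end

section \<open>Factoriality of the associated ring structure\<close>

lemma ring_of_simps:
  "carrier (ring_of S) = S" "x \<otimes>\<^bsub>ring_of S\<^esub> y = x * y" "\<one>\<^bsub>ring_of S\<^esub> = 1"
  "\<zero>\<^bsub>ring_of S\<^esub> = 0" "x \<oplus>\<^bsub>ring_of S\<^esub> y = x + y"
  by (simp_all add: ring_of_def)

lemma (in subdomain) domain_ring_of: "domain (ring_of A)"
proof (intro domain.intro cringI domain_axioms.intro abelian_groupI comm_monoidI)
  show "\<exists>y\<in>carrier (ring_of A). y \<oplus>\<^bsub>ring_of A\<^esub> x = \<zero>\<^bsub>ring_of A\<^esub>" if "x \<in> carrier (ring_of A)" for x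
    using that uminus_mem by (auto simp: ring_of_simps intro!: bexI[of _ "- x"])
qed (auto simp: ring_of_simps algebra_simps intro: one_mem zero_mem add_mem mult_mem)

lemma Units_ring_of: "Units (ring_of A) = units_in A"
  by (auto simp: Units_def units_in_def ring_of_simps mult.commute)

lemma (in subdomain) prime_ring_of:
  assumes "prime_in A p"
  shows "Divisibility.prime (mult_of (ring_of A)) p"
proof -
  interpret R: domain "ring_of A"
    by (rule domain_ring_of)
  have "p \<in> carrier (ring_of A)"
    using assms by (simp add: prime_in_def ring_of_simps)
  moreover have "Divisibility.prime (ring_of A) p"
    using assms by (simp add: Divisibility.prime_def prime_in_def Units_ring_of ring_of_simps
        factor_def dvd_in_def)
  ultimately show ?thesis
    using R.prime_eq_prime_mult by blast
qed

text \<open>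
  In a ring where every irreducible is prime, factorizations into irreducibles are unique, so the
  prime factorizations at hand suffice.
\<close>

theorem (in factorial_subdomain) factorial_domain_ring_of: "factorial_domain (ring_of A)"
proof -
  interpret R: domain "ring_of A"
    by (rule domain_ring_of)
  let ?M = "mult_of (ring_of A)"
  have prime: "Divisibility.prime ?M a" if "a \<in> carrier ?M" "Divisibility.irreducible ?M a" for a
  proof -
    have a: "a \<in> A" "a \<noteq> 0"
      using that(1) by (auto simp: ring_of_simps)
    have irr: "ring_irreducible\<^bsub>ring_of A\<^esub> a"
      using R.ring_irreducibleI' that by simp
    have "prime_in A a"
    proof (rule irreducible_imp_prime_in[OF a])
      show "a \<notin> units_in A"
        using R.ring_irreducibleE(4)[OF _ irr] a by (simp add: Units_ring_of ring_of_simps)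
      show "b \<in> units_in A \<or> c \<in> units_in A" if "b \<in> A" "c \<in> A" "a = b * c" for b c
        using R.ring_irreducibleE(5)[OF _ irr, of b c] a that
        by (simp add: Units_ring_of ring_of_simps)
    qed
    then show ?thesis
      by (rule prime_ring_of)
  qed
  have cancel: "comm_monoid_cancel ?M"
    by (rule R.mult_of.comm_monoid_cancel_axioms)
  have primeness: "primeness_condition_monoid ?M"
    by (intro primeness_condition_monoid.intro R.mult_of.comm_monoid_cancel_axioms
        primeness_condition_monoid_axioms.intro prime)
  have "factorial_monoid ?M"
  proof (rule comm_monoid_cancel.factorial_monoidI[OF cancel])
    fix a assume "a \<in> carrier ?M"
    then have a: "a \<in> A" "a \<noteq> 0"
      by (auto simp: ring_of_simps)
    obtain u ps where u: "u \<in> units_in A" "\<forall>p\<in>set ps. prime_in A p" "a = u * prod_list ps"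
      using prime_factorization[OF a] by blast
    obtain w where w: "w \<in> units_in A" "u * w = 1"
      using u(1) by (rule units_inE)
    have foldr: "foldr (\<otimes>\<^bsub>?M\<^esub>) ps \<one>\<^bsub>?M\<^esub> = prod_list ps"
      by (induction ps) (simp_all add: ring_of_simps)
    have "prod_list ps = a * w"
      using u(3) w(2) by (metis mult.assoc mult.commute mult_1)
    then have "foldr (\<otimes>\<^bsub>?M\<^esub>) ps \<one>\<^bsub>?M\<^esub> \<sim>\<^bsub>?M\<^esub> a"
      unfolding foldr associated_def factor_def using u w units_inD[OF u(1)] units_inD[OF w(1)]
      by (auto simp: ring_of_simps mult.commute)
    moreover have "set ps \<subseteq> carrier ?M"
      using u(2) by (auto simp: ring_of_simps prime_in_def)
    moreover have "\<forall>p\<in>set ps. Divisibility.irreducible ?M p"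
      using u(2) calculation(2) prime_ring_of comm_monoid_cancel.prime_irreducible[OF cancel]
      by blast
    ultimately show "\<exists>fs. set fs \<subseteq> carrier ?M \<and> wfactors ?M fs a"
      unfolding wfactors_def by blast
  next
    fix a fs fs'
    assume "a \<in> carrier ?M" "set fs \<subseteq> carrier ?M" "set fs' \<subseteq> carrier ?M"
      "wfactors ?M fs a" "wfactors ?M fs' a"
    then show "essentially_equal ?M fs fs'"
      by (intro primeness_condition_monoid.wfactors_unique[OF primeness])
  qed
  then show ?thesis
    by (intro factorial_domain.intro domain_ring_of)
qed

section \<open>The upper bound of an LP seed\<close>

context
  fixes x :: "'n::{finite,linorder} \<Rightarrow> ('r::idom, 'n) ratfun"
  assumes x: "alg_independent x" and R: "factorial_subdomain (UNIV :: 'r set)"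
begin

lemma laurent_ring_denominators:
  "denominators (polynomial_ring x) (range (\<lambda>e. \<Prod>i\<in>UNIV. x i ^ e i))"
proof (intro denominators.intro denominators_axioms.intro)
  show "factorial_subdomain (polynomial_ring x)"
    unfolding polynomial_ring_def
    by (intro subdomain_embedding.factorial_image mpol_eval_embedding x factorial_mpol R)
  then interpret factorial_subdomain "polynomial_ring x" .
  have "x i \<in> polynomial_ring x" for i
    unfolding polynomial_ring_def by (metis mpol_eval_pvar rangeI)
  then show "range (\<lambda>e. \<Prod>i\<in>UNIV. x i ^ e i) \<subseteq> polynomial_ring x"
    by (auto intro!: prod_mem power_mem)
  show "0 \<notin> range (\<lambda>e. \<Prod>i\<in>UNIV. x i ^ e i)"
    using alg_independent_nonzero[OF x] by auto
  show "1 \<in> range (\<lambda>e. \<Prod>i\<in>UNIV. x i ^ e i)"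
    by (rule image_eqI[of _ _ "\<lambda>_. 0"]) auto
  fix s t assume "s \<in> range (\<lambda>e. \<Prod>i\<in>UNIV. x i ^ e i)" "t \<in> range (\<lambda>e. \<Prod>i\<in>UNIV. x i ^ e i)"
  then obtain d e where "s = (\<Prod>i\<in>UNIV. x i ^ d i)" "t = (\<Prod>i\<in>UNIV. x i ^ e i)"
    by auto
  then have "s * t = (\<Prod>i\<in>UNIV. x i ^ (d i + e i))"
    by (simp add: power_add prod.distrib)
  then show "s * t \<in> range (\<lambda>e. \<Prod>i\<in>UNIV. x i ^ e i)"
    by (intro range_eqI[of _ _ "\<lambda>i. d i + e i"])
qed

lemma laurent_ring_eq:
  "laurent_ring x = localization (polynomial_ring x) (range (\<lambda>e. \<Prod>i\<in>UNIV. x i ^ e i))"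
  unfolding laurent_ring_def localization_def polynomial_ring_def by blast

lemma factorial_laurent_ring: "factorial_subdomain (laurent_ring x)"
  unfolding laurent_ring_eq by (rule denominators.factorial_localization[OF laurent_ring_denominators])

lemma mpol_eval_mem_laurent_ring: "mpol_eval x p \<in> laurent_ring x"
  unfolding laurent_ring_eq
  by (intro denominators.localization_superset[OF laurent_ring_denominators])
    (simp add: polynomial_ring_def)

lemma cluster_variable_unit: "x i \<in> units_in (laurent_ring x)"
proof -
  interpret denominators "polynomial_ring x" "range (\<lambda>e. \<Prod>i\<in>UNIV. x i ^ e i)"
    by (rule laurent_ring_denominators)
  have "(\<Prod>j\<in>UNIV. x j ^ (if j = i then 1 else 0)) = (\<Prod>j\<in>UNIV. if j = i then x j else 1)"
    by (intro prod.cong) auto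
  then have "x i \<in> range (\<lambda>e. \<Prod>i\<in>UNIV. x i ^ e i)"
    by (intro image_eqI[of _ _ "\<lambda>j. if j = i then 1 else 0"]) auto
  then have "1 / x i \<in> laurent_ring x"
    unfolding laurent_ring_eq by (intro localizationI one_mem)
  moreover have "x i \<in> laurent_ring x"
    using mpol_eval_mem_laurent_ring[of "pvar i"] by (simp add: mpol_eval_pvar)
  ultimately show ?thesis
    using alg_independent_nonzero[OF x, of i] unfolding units_in_def
    by (auto intro!: bexI[of _ "1 / x i"])
qed

lemma laurent_ring_least:
  assumes B: "subdomain B" and const: "\<And>c. const c \<in> B"
    and var: "\<And>i. x i \<in> B" and inv: "\<And>i. inverse (x i) \<in> B"
  shows "laurent_ring x \<subseteq> B"
proof
  interpret subdomain B by fact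
  fix f assume "f \<in> laurent_ring x"
  then obtain p e where f: "f = mpol_eval x p / (\<Prod>i\<in>UNIV. x i ^ e i)"
    by (auto simp: laurent_ring_def)
  have "f = mpol_eval x p * (\<Prod>i\<in>UNIV. inverse (x i) ^ e i)"
    unfolding f by (simp add: divide_inverse power_inverse prod_inversef[symmetric] o_def)
  moreover have "mpol_eval x p \<in> B"
    unfolding mpol_eval_def by (intro sum_mem mult_mem prod_mem power_mem const var)
  ultimately show "f \<in> B"
    by (auto intro!: mult_mem prod_mem power_mem inv)
qed

text \<open>
  As the polynomial ring is factorial, \<open>f\<close> is prime there, and it stays prime in the Laurent ring
  unless it divides a monomial. In that case it divides a variable; being prime too, the variable
  is associated with \<open>f\<close>, contrary to the assumption.
\<close>

lemma exchange_polynomial_prime: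
  assumes irr: "Factorial_Ring.irreducible f" and var: "\<And>j. \<not> pvar j dvd f"
  shows "prime_in (laurent_ring x) (mpol_eval x f)"
  unfolding laurent_ring_eq
proof (rule denominators.prime_in_localization[OF laurent_ring_denominators])
  interpret emb: subdomain_embedding UNIV "mpol_eval x"
    by (rule mpol_eval_embedding[OF x])
  interpret mpol: factorial_subdomain "UNIV :: ('r, 'n) mpol set"
    by (rule factorial_mpol[OF R])
  have f: "prime_in UNIV f"
    using irr by (intro mpol.irreducible_imp_prime_in)
      (auto simp: Factorial_Ring.irreducible_def units_in_UNIV)
  then show "prime_in (polynomial_ring x) (mpol_eval x f)"
    unfolding polynomial_ring_def by (rule emb.prime_in_image)
  have prime_f: "Factorial_Ring.prime_elem f"
    using f by (simp add: prime_in_UNIV)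
  have not_dvd_pvar: "\<not> f dvd pvar j" for j
  proof
    assume "f dvd pvar j"
    then obtain c where c: "c \<in> units_in UNIV" "pvar j = f * c"
      using emb.primes_associated[OF f pvar_prime] by (auto simp: dvd_in_UNIV)
    then obtain d where "c * d = 1"
      by (auto simp: units_in_def)
    then have "f = pvar j * d"
      using c(2) by (simp add: mult.assoc)
    then show False
      using var[of j] by simp
  qed
  have not_dvd: "\<not> f dvd (\<Prod>i\<in>I. pvar i ^ e i)" for I e
    by (induction I rule: infinite_finite_induct)
      (use prime_f not_dvd_pvar in \<open>auto simp: prime_elem_dvd_mult_iff prime_elem_not_unit
        dest: prime_elem_dvd_power\<close>)
  fix s assume "s \<in> range (\<lambda>e. \<Prod>i\<in>UNIV. x i ^ e i)"
  then obtain e where e: "s = (\<Prod>i\<in>UNIV. x i ^ e i)"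
    by auto
  have "s = mpol_eval x (\<Prod>i\<in>UNIV. pvar i ^ e i)"
    by (simp add: e mpol_eval_prod mpol_eval_power mpol_eval_pvar)
  then show "\<not> dvd_in (polynomial_ring x) (mpol_eval x f) s"
    unfolding polynomial_ring_def using not_dvd by (simp add: emb.dvd_in_image dvd_in_UNIV)
qed

end

text \<open>
  The valuation dual to \<open>x k\<close> is the order at \<open>F k\<close> in the Laurent ring \<open>D k\<close> of the cluster mutated
  in direction \<open>k\<close>. In \<open>D k\<close> the exchange relation reads \<open>x k = q k * u\<close> with a unit \<open>u\<close>.
\<close>

theorem factorial_upper_bound:
  fixes x :: "'n::{finite,linorder} \<Rightarrow> ('r::idom, 'n) ratfun"
  assumes R: "factorial_subdomain (UNIV :: 'r set)" and seed: "lp_seed (x, F)"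
  shows "factorial_subdomain (laurent_ring x \<inter> (\<Inter>k. laurent_ring (mutated_cluster k (x, F))))"
proof -
  have x: "alg_independent x" and irr: "\<And>k. Factorial_Ring.irreducible (F k)"
    and not_dvd: "\<And>j k. \<not> pvar j dvd F k" and F_k: "\<And>k. k \<notin> pvars (F k)"
    using seed by (auto simp: lp_seed_def)
  have F_in: "F k \<in> mpols_in (UNIV - {k})" for k
    using F_k[of k] by (auto simp: mpols_in_def)
  define m where "m k = (\<Prod>j\<in>UNIV - {k}. pvar j ^ exch_exponent F k j :: ('r, 'n) mpol)" for k
  define x' where "x' k = mutated_cluster k (x, F)" for k
  define D where "D k = laurent_ring (x' k)" for k
  define q where "q k = mpol_eval x (F k)" for k
  have m_in: "m k \<in> mpols_in (UNIV - {k})" for k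
  proof -
    interpret subdomain "mpols_in (UNIV - {k}) :: ('r, 'n) mpol set"
      by (rule mpols_in_subdomain)
    show ?thesis
      unfolding m_def by (intro prod_mem power_mem pvar_mem_mpols_in) auto
  qed
  have x'_eq: "x' k = x(k := q k / mpol_eval x (m k) / x k)" for k
    unfolding x'_def q_def m_def by (rule mutated_cluster_eq[OF x])
  have x': "alg_independent (x' k)" for k
    unfolding x'_eq q_def using irr[of k]
    by (intro alg_independent_exchange x F_in m_in)
      (auto simp: m_def pvar_nonzero)
  have eval_eq: "mpol_eval (x' k) p = mpol_eval x p" if "p \<in> mpols_in (UNIV - {k})" for p k
    using that by (rule mpol_eval_cong) (simp add: x'_eq)
  have q_prime: "prime_in (D k) (q k)" for k
    unfolding D_def q_def using exchange_polynomial_prime[OF x' R irr not_dvd] eval_eq[OF F_in]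
    by metis
  interpret D: prime_order "D k" "q k" for k
    unfolding D_def
    by (intro prime_order.intro prime_order_axioms.intro factorial_laurent_ring x' R
        q_prime[unfolded D_def])
  interpret frac: subdomain "D.fractions k" for k
    by (rule D.fractions_subdomain)
  have unit_D: "x j \<in> units_in (D k)" if "j \<noteq> k" for j k
    using cluster_variable_unit[OF x' R, of k j] that by (simp add: D_def x'_eq)
  have x_k: "\<exists>u\<in>units_in (D k). x k = q k * u" for k
  proof -
    have mk: "mpol_eval x (m k) \<in> units_in (D k)"
    proof -
      have "(\<Prod>j\<in>J. x j ^ exch_exponent F k j) \<in> units_in (D k)" if "k \<notin> J" for J
        using that
      proof (induction J rule: infinite_finite_induct)
        case (insert j J)
        have "x j ^ n \<in> units_in (D k)" for n
          using insert.prems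
          by (induction n) (auto intro: D.one_units_in D.mult_units_in unit_D)
        with insert show ?case
          by (auto intro: D.mult_units_in)
      qed (auto intro: D.one_units_in)
      then show ?thesis
        by (simp add: m_def mpol_eval_prod mpol_eval_power mpol_eval_pvar)
    qed
    have xk': "x' k k \<in> units_in (D k)"
      unfolding D_def by (rule cluster_variable_unit[OF x' R])
    obtain u where u: "u \<in> units_in (D k)" "mpol_eval x (m k) * x' k k * u = 1"
      by (rule units_inE[OF D.mult_units_in[OF mk xk']])
    have qk: "mpol_eval x (m k) * x' k k * x k = q k"
      using units_inD(2)[OF mk] alg_independent_nonzero[OF x, of k] by (simp add: x'_eq)
    have "q k * u = mpol_eval x (m k) * x' k k * u * x k"
      unfolding qk[symmetric] by (simp only: ac_simps)
    then have "x k = q k * u"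
      unfolding u(2) by simp
    with u(1) show ?thesis
      by blast
  qed
  have const_D: "const c \<in> D k" for c k
    unfolding D_def using mpol_eval_mem_laurent_ring[OF x' R, of k "Poly_Mapping.single 0 c"]
    by (simp add: mpol_eval_const)
  have sub: "laurent_ring x \<subseteq> D.fractions k" for k
  proof (rule laurent_ring_least[OF x R D.fractions_subdomain])
    show "const c \<in> D.fractions k" for c
      using const_D D.subset_fractions by blast
    fix i
    have "x i \<in> D.fractions k \<and> inverse (x i) \<in> D.fractions k"
    proof -
      have inv_unit: "inverse u \<in> D k" if u: "u \<in> units_in (D k)" for u
      proof -
        obtain w where "w \<in> units_in (D k)" "u * w = 1"
          using u by (rule units_inE)
        moreover from this have "inverse u = w"
          by (metis inverse_unique)
        ultimately show ?thesis
          by (simp add: units_inD)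
      qed
      show ?thesis
      proof (cases "i = k")
        case True
        obtain u where u: "u \<in> units_in (D k)" "x k = q k * u"
          using x_k by blast
        then have "inverse (x k) = inverse (q k) * inverse u"
          by simp
        moreover have "inverse u \<in> D.fractions k" "u \<in> D.fractions k" "q k \<in> D.fractions k"
          using D.subset_fractions inv_unit[OF u(1)] D.qD(1) units_inD(1)[OF u(1)] by blast+
        ultimately show ?thesis
          unfolding True u(2) using D.inverse_q_fractions by (auto intro: frac.mult_mem)
      next
        case False
        then show ?thesis
          using unit_D inv_unit D.subset_fractions units_inD(1) by blast
      qed
    qed
    then show "x i \<in> D.fractions k" "inverse (x i) \<in> D.fractions k"
      by auto
  qed
  interpret L: factorial_subdomain "laurent_ring x"
    by (rule factorial_laurent_ring[OF x R])
  interpret V: dual_valuations "laurent_ring x" "\<lambda>k. D.order_at k" x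
  proof
    show "D.order_at i (a * b) = D.order_at i a + D.order_at i b"
      if "a \<in> laurent_ring x" "b \<in> laurent_ring x" "a \<noteq> 0" "b \<noteq> 0" for a b i
      using that sub by (intro D.order_at_mult) auto
    show "x i \<in> units_in (laurent_ring x)" for i
      by (rule cluster_variable_unit[OF x R])
    show "D.order_at i (x j) = (if i = j then 1 else 0)" for i j
      using x_k[of i] unit_D[of j i] D.order_at_unit D.order_at_prime_mult_unit by auto
  qed
  have eq: "V.nonneg = laurent_ring x \<inter> (\<Inter>k. D k)"
  proof -
    have "(f = 0 \<or> (\<forall>k. D.order_at k f \<ge> 0)) \<longleftrightarrow> (\<forall>k. f \<in> D k)" if "f \<in> laurent_ring x" for f
    proof (cases "f = 0")
      case False
      then have "D.order_at k f \<ge> 0 \<longleftrightarrow> f \<in> D k" for k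
        using that sub by (intro D.order_at_nonneg_iff) auto
      with False show ?thesis
        by simp
    qed (simp add: D.zero_mem)
    then show ?thesis
      unfolding V.nonneg_def by auto
  qed
  have "subdomain V.nonneg"
    unfolding eq
    by standard (auto intro: L.one_mem L.diff_mem L.mult_mem D.one_mem D.diff_mem D.mult_mem)
  from V.factorial_nonneg[OF this]
  have "factorial_subdomain (laurent_ring x \<inter> (\<Inter>k. D k))"
    unfolding eq .
  then show ?thesis
    by (simp add: D_def x'_def)
qed

theorem theorem5p19:
  fixes x :: "'n::{finite,linorder} \<Rightarrow> ('r::{idom,ring_char_0}, 'n) ratfun"
    and F :: "'n \<Rightarrow> ('r, 'n) mpol"
    and U :: "('r, 'n) ratfun set"
  assumes R: "surj (of_int :: int \<Rightarrow> 'r) \<or> (\<forall>a::'r. a \<noteq> 0 \<longrightarrow> a dvd 1)"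
    and seed: "lp_seed (x, F)"
    and U: "U = upper_lp_algebra (x, F)"
    and bound: "U = laurent_ring x \<inter> (\<Inter>k. laurent_ring (mutated_cluster k (x, F)))"
  shows "factorial_domain (ring_of U)"
  unfolding bound
  by (intro factorial_subdomain.factorial_domain_ring_of factorial_upper_bound
      factorial_base_ring R seed)

end
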